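(* Let $Q$ be one of the quadratic spline quasi-interpolants $S_2$, $W_2^*$ on $\Omega$. There exists a constant $C_0>0$, with $C_0\le 20.5$ for $Q=S_2$ and $C_0\le 12$ for $Q=W_2^*$, such that, for every $f\in C(\Omega)$, $$\|f-Qf\|_\Omega\le C_0\,\omega\left(f,\tfrac12 h\right).$$
   Context: Partition. Let $m,n\ge 1$ be integers, $\Omega=[a,b]\times[c,d]$, $a=x_0<x_1<\dots<x_m=b$ and $c=y_0<y_1<\dots<y_n=d$, with the conventions $x_{-1}=x_0$, $x_{m+1}=x_m$, $y_{-1}=y_0$, $y_{n+1}=y_n$. Put $h_i=x_i-x_{i-1}$, $k_j=y_j-y_{j-1}$ (so $h_0=h_{m+1}=k_0=k_{n+1}=0$), $s_i=\frac12(x_{i-1}+x_i)$, $t_j=\frac12(y_{j-1}+y_j)$ for $0\le i\le m+1$, $0\le j\le n+1$. Put $M_{i,j}=(s_i,t_j)$ for these indices and $A_{i,j}=(x_i,y_j)$ for $-1\le i\le m+1$, $-1\le j\le n+1$. The criss-cross triangulation $\mathcal T_{mn}$ of $\Omega$ is obtained by drawing both diagonals in each subrectangle $\Omega_{ij}=[x_{i-1},x_i]\times[y_{j-1},y_j]$, $1\le i\le m$, $1\le j\le n$. B-splines. Choose extended knots $u_{-2}<u_{-1}<u_0<\dots<u_m<u_{m+1}<u_{m+2}$ with $u_i=x_i$ for $0\le i\le m$, and $v_{-2}<v_{-1}<v_0<\dots<v_n<v_{n+1}<v_{n+2}$ with $v_j=y_j$ for $0\le j\le n$. For $0\le i\le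 m+1$, $0\le j\le n+1$, the classical B-spline $\overline B_{ij}$ is the unique $C^1$ function on $\mathbb R^2$ that is a polynomial of total degree at most 2 on each triangle of the criss-cross triangulation (both diagonals in each subrectangle) of the grid $\{u_p\}\times\{v_q\}$, vanishes outside the octagon with vertices $(u_{i-2},v_{j-1}),(u_{i-2},v_j),(u_{i-1},v_{j+1}),(u_i,v_{j+1}),(u_{i+1},v_j),(u_{i+1},v_{j-1}),(u_i,v_{j-2}),(u_{i-1},v_{j-2})$, and is normalized by $\overline B_{ij}(u_i,v_j)=\frac{u_{i+1}-u_i}{u_{i+1}-u_{i-1}}\cdot\frac{v_{j+1}-v_j}{v_{j+1}-v_{j-1}}$. Let $\bar h_0=u_0-u_{-1}$, $\bar h_{m+1}=u_{m+1}-u_m$, $\bar k_0=v_0-v_{-1}$, $\bar k_{n+1}=v_{n+1}-v_n$. Define $\alpha_{00}=\frac{\bar h_0+h_1}{h_1}$, $\alpha_{m+1,m+1}=\frac{h_m+\bar h_{m+1}}{h_m}$, $\alpha_{ii}=1$ for $1\le i\le m$, $\alpha_{1,0}=-\frac{\bar h_0}{h_1}$, $\alpha_{m,m+1}=-\frac{\bar h_{m+1}}{h_m}$, all other $\alpha_{ip}=0$; and define $\beta_{jq}$ in the same way with $n,k,\bar k$ in place of $m,h,\bar h$. The B-spline $B_{ij}$ is the restriction to $\Omega$ of $\sum_{p=0}^{m+1}\sum_{q=0}^{n+1}\alpha_{ip}\beta_{jq}\overline B_{pq}$. The functions $B_{ij}$ are nonnegative, have supports in $\Omega$, and sum to 1.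 Quasi-interpolants. For $2\le i\le m$ put $\sigma_i=\frac{h_i}{h_{i-1}+h_i}$, $\sigma_i'=1-\sigma_i$; for $2\le j\le n$ put $\tau_j=\frac{k_j}{k_{j-1}+k_j}$, $\tau_j'=1-\tau_j$; and $\sigma_1=\sigma'_{m+1}=\tau_1=\tau'_{n+1}=1$, $\sigma_1'=\sigma_{m+1}=\tau_1'=\tau_{n+1}=0$. For $1\le i\le m$, $1\le j\le n$, $$a_i=-\frac{\sigma_i^2\sigma_{i+1}'}{\sigma_i+\sigma_{i+1}'},\quad c_i=-\frac{\sigma_i(\sigma_{i+1}')^2}{\sigma_i+\sigma_{i+1}'},\quad \bar a_j=-\frac{\tau_j^2\tau_{j+1}'}{\tau_j+\tau_{j+1}'},\quad \bar c_j=-\frac{\tau_j(\tau_{j+1}')^2}{\tau_j+\tau_{j+1}'},$$ and $a_0=c_0=a_{m+1}=c_{m+1}=\bar a_0=\bar c_0=\bar a_{n+1}=\bar c_{n+1}=0$; $b_{ij}=1-(a_i+c_i+\bar a_j+\bar c_j)$. Then $S_2f=\sum_{i=0}^{m+1}\sum_{j=0}^{n+1}\mu_{ij}(f)B_{ij}$ with $\mu_{ij}(f)=b_{ij}f(M_{i,j})+a_if(M_{i-1,j})+c_if(M_{i+1,j})+\bar a_jf(M_{i,j-1})+\bar c_jf(M_{i,j+1})$ (terms with zero coefficient are omitted), and $W_2^*f=\sum_{i=0}^{m+1}\sum_{j=0}^{n+1}\mu^*_{ij}(f)B_{ij}$ with $\mu^*_{ij}(f)=2f(M_{i,j})-\frac14[f(A_{i-1,j-1})+f(A_{i-1,j})+f(A_{i,j-1})+f(A_{i,j})]$.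 Notation. $h=\max\{h_i,k_j: 1\le i\le m,\,1\le j\le n\}$; $\|\cdot\|_\Omega$ is the supremum norm over $\Omega$; for $\psi\in C(\Omega)$, $\omega(\psi,t)=\max\{|\psi(M)-\psi(P)|: M,P\in\Omega,\ \|MP\|\le t\}$, where $\|MP\|$ is the Euclidean distance. *)

theory Defs
  imports "HOL-Analysis.Analysis"
begin

text \<open>
  A one-dimensional partition \<open>x 0 < \<dots> < x m\<close> of an interval is a function on the integers,
  of which only the values at the indices \<open>- 1, \<dots>, m + 1\<close> matter; the two boundary conventions
  \<open>x (- 1) = x 0\<close> and \<open>x (m + 1) = x m\<close> are part of the predicate.
\<close>

definition is_partition :: "int \<Rightarrow> real \<Rightarrow> real \<Rightarrow> (int \<Rightarrow> real) \<Rightarrow> bool" where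
  "is_partition m a b x \<longleftrightarrow>
     x 0 = a \<and> x m = b \<and> (\<forall>i\<in>{1..m}. x (i - 1) < x i) \<and> x (- 1) = x 0 \<and> x (m + 1) = x m"

definition is_extended_knots :: "int \<Rightarrow> (int \<Rightarrow> real) \<Rightarrow> (int \<Rightarrow> real) \<Rightarrow> bool" where
  "is_extended_knots m x u \<longleftrightarrow>
     (\<forall>i\<in>{- 1..m + 2}. u (i - 1) < u i) \<and> (\<forall>i\<in>{0..m}. u i = x i)"

definition stp :: "(int \<Rightarrow> real) \<Rightarrow> int \<Rightarrow> real" where
  "stp x i = x i - x (i - 1)"

definition mid :: "(int \<Rightarrow> real) \<Rightarrow> int \<Rightarrow> real" where
  "mid x i = (x (i - 1) + x i) / 2"

definition mesh :: "int \<Rightarrow> int \<Rightarrow> (int \<Rightarrow> real) \<Rightarrow> (int \<Rightarrow> real) \<Rightarrow> real" where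
  "mesh m n x y = Max (stp x ` {1..m} \<union> stp y ` {1..n})"


subsection \<open>Classical B-splines\<close>

text \<open>The four triangles cut out of \<open>[u (p - 1), u p] \<times> [v (q - 1), v q]\<close> by its two diagonals.\<close>

definition cell_triangles ::
  "(int \<Rightarrow> real) \<Rightarrow> (int \<Rightarrow> real) \<Rightarrow> int \<Rightarrow> int \<Rightarrow> (real \<times> real) set set" where
  "cell_triangles u v p q =
    (let z = (mid u p, mid v q);
         sw = (u (p - 1), v (q - 1)); se = (u p, v (q - 1));
         ne = (u p, v q); nw = (u (p - 1), v q)
     in {convex hull {z, sw, se}, convex hull {z, se, ne},
         convex hull {z, ne, nw}, convex hull {z, nw, sw}})"

definition criss_cross ::
  "int \<Rightarrow> int \<Rightarrow> (int \<Rightarrow> real) \<Rightarrow> (int \<Rightarrow> real) \<Rightarrow> (real \<times> real) set set" where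
  "criss_cross m n u v = (\<Union>p\<in>{- 1..m + 2}. \<Union>q\<in>{- 1..n + 2}. cell_triangles u v p q)"

definition quadratic_on :: "(real \<times> real) set \<Rightarrow> (real \<times> real \<Rightarrow> real) \<Rightarrow> bool" where
  "quadratic_on T g \<longleftrightarrow>
    (\<exists>c0 c1 c2 c3 c4 c5. \<forall>(s, t)\<in>T.
       g (s, t) = c0 + c1 * s + c2 * t + c3 * s\<^sup>2 + c4 * s * t + c5 * t\<^sup>2)"

definition C1_plane :: "(real \<times> real \<Rightarrow> real) \<Rightarrow> bool" where
  "C1_plane g \<longleftrightarrow>
    (\<exists>D :: real \<times> real \<Rightarrow> ((real \<times> real) \<Rightarrow>\<^sub>L real).
       (\<forall>P. (g has_derivative blinfun_apply (D P)) (at P)) \<and> continuous_on UNIV D)"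

definition octagon ::
  "(int \<Rightarrow> real) \<Rightarrow> (int \<Rightarrow> real) \<Rightarrow> int \<Rightarrow> int \<Rightarrow> (real \<times> real) set" where
  "octagon u v i j = convex hull
     {(u (i - 2), v (j - 1)), (u (i - 2), v j), (u (i - 1), v (j + 1)), (u i, v (j + 1)),
      (u (i + 1), v j), (u (i + 1), v (j - 1)), (u i, v (j - 2)), (u (i - 1), v (j - 2))}"

definition is_classical_bspline ::
  "int \<Rightarrow> int \<Rightarrow> (int \<Rightarrow> real) \<Rightarrow> (int \<Rightarrow> real) \<Rightarrow> int \<Rightarrow> int \<Rightarrow> (real \<times> real \<Rightarrow> real) \<Rightarrow> bool" where
  "is_classical_bspline m n u v i j g \<longleftrightarrow>
     C1_plane g \<and>
     (\<forall>T\<in>criss_cross m n u v. quadratic_on T g) \<and>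
     (\<forall>P. P \<notin> octagon u v i j \<longrightarrow> g P = 0) \<and>
     g (u i, v j) = (u (i + 1) - u i) / (u (i + 1) - u (i - 1)) *
                    ((v (j + 1) - v j) / (v (j + 1) - v (j - 1)))"

definition classical_bspline ::
  "int \<Rightarrow> int \<Rightarrow> (int \<Rightarrow> real) \<Rightarrow> (int \<Rightarrow> real) \<Rightarrow> int \<Rightarrow> int \<Rightarrow> real \<times> real \<Rightarrow> real" where
  "classical_bspline m n u v i j = (THE g. is_classical_bspline m n u v i j g)"


subsection \<open>B-splines adapted to the boundary\<close>

text \<open>
  Since \<open>u\<close> agrees with \<open>x\<close> on \<open>0, \<dots>, m\<close>, \<open>stp u i = stp x i\<close> for \<open>1 \<le> i \<le> m\<close>, while
  \<open>stp u 0\<close> and \<open>stp u (m + 1)\<close> are the lengths of the first auxiliary intervals outside the domain.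
\<close>

definition bdry_coeff :: "int \<Rightarrow> (int \<Rightarrow> real) \<Rightarrow> int \<Rightarrow> int \<Rightarrow> real" where
  "bdry_coeff m u i p =
    (if i = 0 \<and> p = 0 then (stp u 0 + stp u 1) / stp u 1
     else if i = m + 1 \<and> p = m + 1 then (stp u m + stp u (m + 1)) / stp u m
     else if 1 \<le> i \<and> i \<le> m \<and> p = i then 1
     else if i = 1 \<and> p = 0 then - (stp u 0 / stp u 1)
     else if i = m \<and> p = m + 1 then - (stp u (m + 1) / stp u m)
     else 0)"

text \<open>
  The functions below are defined on the whole plane, but are only ever evaluated on the
  rectangular domain.
\<close>

definition bspline ::
  "int \<Rightarrow> int \<Rightarrow> (int \<Rightarrow> real) \<Rightarrow> (int \<Rightarrow> real) \<Rightarrow> int \<Rightarrow> int \<Rightarrow> real \<times> real \<Rightarrow> real" where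
  "bspline m n u v i j P =
    (\<Sum>p\<in>{0..m + 1}. \<Sum>q\<in>{0..n + 1}.
       bdry_coeff m u i p * bdry_coeff n v j q * classical_bspline m n u v p q P)"


subsection \<open>Quasi-interpolants\<close>

definition sigma :: "int \<Rightarrow> (int \<Rightarrow> real) \<Rightarrow> int \<Rightarrow> real" where
  "sigma m x i = (if i = 1 then 1 else if i = m + 1 then 0 else stp x i / (stp x (i - 1) + stp x i))"

definition sigma' :: "int \<Rightarrow> (int \<Rightarrow> real) \<Rightarrow> int \<Rightarrow> real" where
  "sigma' m x i = 1 - sigma m x i"

definition a_coeff :: "int \<Rightarrow> (int \<Rightarrow> real) \<Rightarrow> int \<Rightarrow> real" where
  "a_coeff m x i =
    (if 1 \<le> i \<and> i \<le> m
     then - ((sigma m x i)\<^sup>2 * sigma' m x (i + 1) / (sigma m x i + sigma' m x (i + 1))) else 0)"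

definition c_coeff :: "int \<Rightarrow> (int \<Rightarrow> real) \<Rightarrow> int \<Rightarrow> real" where
  "c_coeff m x i =
    (if 1 \<le> i \<and> i \<le> m
     then - (sigma m x i * (sigma' m x (i + 1))\<^sup>2 / (sigma m x i + sigma' m x (i + 1))) else 0)"

definition b_coeff ::
  "int \<Rightarrow> int \<Rightarrow> (int \<Rightarrow> real) \<Rightarrow> (int \<Rightarrow> real) \<Rightarrow> int \<Rightarrow> int \<Rightarrow> real" where
  "b_coeff m n x y i j = 1 - (a_coeff m x i + c_coeff m x i + a_coeff n y j + c_coeff n y j)"

text \<open>
  For \<open>0 \<le> i \<le> m + 1\<close> and \<open>0 \<le> j \<le> n + 1\<close>, midpoints with an index out of range occur here
  only with coefficient \<open>0\<close>.
\<close>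

definition mu_S2 ::
  "int \<Rightarrow> int \<Rightarrow> (int \<Rightarrow> real) \<Rightarrow> (int \<Rightarrow> real) \<Rightarrow> int \<Rightarrow> int \<Rightarrow> (real \<times> real \<Rightarrow> real) \<Rightarrow> real" where
  "mu_S2 m n x y i j f =
     b_coeff m n x y i j * f (mid x i, mid y j)
     + a_coeff m x i * f (mid x (i - 1), mid y j) + c_coeff m x i * f (mid x (i + 1), mid y j)
     + a_coeff n y j * f (mid x i, mid y (j - 1)) + c_coeff n y j * f (mid x i, mid y (j + 1))"

definition mu_W2 ::
  "(int \<Rightarrow> real) \<Rightarrow> (int \<Rightarrow> real) \<Rightarrow> int \<Rightarrow> int \<Rightarrow> (real \<times> real \<Rightarrow> real) \<Rightarrow> real" where
  "mu_W2 x y i j f =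
     2 * f (mid x i, mid y j)
     - (f (x (i - 1), y (j - 1)) + f (x (i - 1), y j) + f (x i, y (j - 1)) + f (x i, y j)) / 4"

definition S2 ::
  "int \<Rightarrow> int \<Rightarrow> (int \<Rightarrow> real) \<Rightarrow> (int \<Rightarrow> real) \<Rightarrow> (int \<Rightarrow> real) \<Rightarrow> (int \<Rightarrow> real) \<Rightarrow>
   (real \<times> real \<Rightarrow> real) \<Rightarrow> real \<times> real \<Rightarrow> real" where
  "S2 m n x y u v f P =
    (\<Sum>i\<in>{0..m + 1}. \<Sum>j\<in>{0..n + 1}. mu_S2 m n x y i j f * bspline m n u v i j P)"

definition W2 ::
  "int \<Rightarrow> int \<Rightarrow> (int \<Rightarrow> real) \<Rightarrow> (int \<Rightarrow> real) \<Rightarrow> (int \<Rightarrow> real) \<Rightarrow> (int \<Rightarrow> real) \<Rightarrow>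
   (real \<times> real \<Rightarrow> real) \<Rightarrow> real \<times> real \<Rightarrow> real" where
  "W2 m n x y u v f P =
    (\<Sum>i\<in>{0..m + 1}. \<Sum>j\<in>{0..n + 1}. mu_W2 x y i j f * bspline m n u v i j P)"


subsection \<open>Norm and modulus of continuity\<close>

text \<open>
  Both suprema are taken over bounded nonempty sets of reals when the function is continuous on the
  nonempty compact set \<open>\<Omega>\<close> and \<open>t \<ge> 0\<close>, and are then maxima. The distance on \<open>real \<times> real\<close>
  is the Euclidean one.
\<close>

definition sup_norm :: "(real \<times> real) set \<Rightarrow> (real \<times> real \<Rightarrow> real) \<Rightarrow> real" where
  "sup_norm \<Omega> g = (SUP P\<in>\<Omega>. \<bar>g P\<bar>)"

definition modulus :: "(real \<times> real) set \<Rightarrow> (real \<times> real \<Rightarrow> real) \<Rightarrow> real \<Rightarrow> real" where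
  "modulus \<Omega> \<psi> t = Sup {\<bar>\<psi> M - \<psi> P\<bar> | M P. M \<in> \<Omega> \<and> P \<in> \<Omega> \<and> dist M P \<le> t}"

end

theory Submission
  imports Defs
begin

text \<open>
  A \<open>C\<^sup>1\<close> criss-cross quadratic is determined by its values and gradients at the grid points, and along
  a grid line its difference quotient is the mean of the two end derivatives. Hence the classical B-spline
  exists and is unique: it is the criss-cross Hermite interpolant, at the grid points, of the
  tensor product of two univariate quadratic B-splines. This interpolation is linear,
  reproduces \<open>1\<close> and maps tensor products of Bernstein polynomials to nonnegative functions, so the
  boundary-adapted \<open>B i j\<close>, whose univariate factors are the B-splines with multiple end knots, are a
  nonnegative partition of unity on \<open>\<Omega>\<close>. On a cell only the nine neighbouring indices contribute, where
  \<open>M i j\<close> is at most \<open>5\<close> steps of length \<open>h / 2\<close> away. The functional \<open>\<mu> i j f\<close> differs from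
  \<open>f (M i j)\<close> by at most \<open>4\<close> moduli of continuity for \<open>S2\<close> and \<open>2\<close> for \<open>W2\<close>, which gives the constants
  \<open>9\<close> and \<open>7\<close>.
\<close>

subsection \<open>Criss-cross quadratics on one cell\<close>

text \<open>\<open>J\<close> carries a value and its gradient together, so that C1 functions given
  on closed pieces can be glued as soon as these pairs agree on overlaps.\<close>

definition jet_on :: "(real \<times> real) set \<Rightarrow> (real \<times> real \<Rightarrow> real \<times> real \<times> real) \<Rightarrow> bool" where
  "jet_on S J \<longleftrightarrow> continuous_on S J \<and>
     (\<forall>P\<in>S. ((\<lambda>P. fst (J P)) has_derivative (\<lambda>V. V \<bullet> snd (J P))) (at P within S))"

lemma jet_on_cong:
  assumes "jet_on S J" "\<And>P. P \<in> S \<Longrightarrow> J P = J' P"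
  shows "jet_on S J'"
  unfolding jet_on_def
proof (intro conjI ballI)
  show "continuous_on S J'"
    using assms continuous_on_cong[of S S J J'] unfolding jet_on_def by blast
  fix P assume P: "P \<in> S"
  have "((\<lambda>P. fst (J P)) has_derivative (\<lambda>V. V \<bullet> snd (J P))) (at P within S)"
    using assms(1) P unfolding jet_on_def by blast
  then show "((\<lambda>P. fst (J' P)) has_derivative (\<lambda>V. V \<bullet> snd (J' P))) (at P within S)"
    unfolding assms(2)[OF P]
    by (rule has_derivative_transform[OF P, rotated]) (simp add: assms(2))
qed

lemma jet_on_subset:
  assumes "jet_on T J" "S \<subseteq> T"
  shows "jet_on S J"
  unfolding jet_on_def
proof (intro conjI ballI)
  show "continuous_on S J"
    using assms continuous_on_subset unfolding jet_on_def by blast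
  show "((\<lambda>P. fst (J P)) has_derivative (\<lambda>V. V \<bullet> snd (J P))) (at P within S)" if "P \<in> S" for P
    using assms that unfolding jet_on_def by (blast intro: has_derivative_subset)
qed

text \<open>The limit along a union holds if it holds along both sets. At a point outside one of
  them, closedness makes the filter within that set trivial, so its derivative condition is
  vacuous.\<close>

lemma jet_on_Un:
  assumes "closed S" "closed T" "jet_on S J" "jet_on T J"
  shows "jet_on (S \<union> T) J"
proof -
  have vac: "((\<lambda>P. fst (J P)) has_derivative (\<lambda>V. V \<bullet> snd (J P))) (at P within R)"
    if "closed R" "jet_on R J" for P R
  proof (cases "P \<in> R")
    case True then show ?thesis using that by (auto simp: jet_on_def)
  next
    case False
    then have "at P within R = bot"
      using that(1) by (simp add: at_within_eq_bot_iff)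
    then show ?thesis
      unfolding has_derivative_within by (simp add: bounded_linear_inner_left)
  qed
  show ?thesis
    unfolding jet_on_def
  proof (intro conjI ballI)
    show "continuous_on (S \<union> T) J"
      using assms by (simp add: jet_on_def continuous_on_closed_Un)
    show "((\<lambda>P. fst (J P)) has_derivative (\<lambda>V. V \<bullet> snd (J P))) (at P within S \<union> T)" for P
      using vac[OF assms(1,3), of P] vac[OF assms(2,4), of P]
      unfolding has_derivative_within by (blast intro: Lim_Un)
  qed
qed

lemma jet_on_UNION:
  assumes "finite I" "\<And>i. i \<in> I \<Longrightarrow> closed (S i)" "\<And>i. i \<in> I \<Longrightarrow> jet_on (S i) J"
  shows "jet_on (\<Union>i\<in>I. S i) J"
  using assms
proof (induction I rule: finite_induct)
  case empty show ?case by (simp add: jet_on_def)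
next
  case (insert i I)
  then show ?case by (auto intro!: jet_on_Un closed_UN)
qed

lemma C1_plane_jet: assumes "jet_on UNIV J" shows "C1_plane (\<lambda>P. fst (J P))"
  unfolding C1_plane_def
proof (intro exI conjI allI)
  show "((\<lambda>P. fst (J P)) has_derivative blinfun_apply (blinfun_inner_left (snd (J P)))) (at P)" for P
    using assms unfolding jet_on_def by (simp del: split_paired_All)
  show "continuous_on UNIV (\<lambda>P. blinfun_inner_left (snd (J P)))"
    using assms unfolding jet_on_def by (auto intro!: continuous_intros)
qed

section \<open>Truncated squares and the Hermite interpolant on the unit square\<close>

definition sqpos :: "real \<Rightarrow> real" where "sqpos r = (max r 0)\<^sup>2"

lemma sqpos_nonneg_arg: "0 \<le> r \<Longrightarrow> sqpos r = r\<^sup>2"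
  and sqpos_nonpos_arg: "r \<le> 0 \<Longrightarrow> sqpos r = 0"
  by (auto simp: sqpos_def max_def)

lemma has_real_derivative_sqpos: "(sqpos has_real_derivative 2 * max r 0) (at r)"
proof -
  consider "r < 0" | "r = 0" | "r > 0" by linarith
  then show ?thesis
  proof cases
    case 1
    have "((\<lambda>_. 0) has_real_derivative 2 * max r 0) (at r)"
      using 1 by simp
    then show ?thesis
      by (rule has_field_derivative_transform_within_open[where S="{..<0}"])
        (use 1 in \<open>auto simp: sqpos_nonpos_arg\<close>)
  next
    case 3
    have "((\<lambda>x. x\<^sup>2) has_real_derivative 2 * max r 0) (at r)"
      using 3 by (auto intro!: derivative_eq_intros)
    then show ?thesis
      by (rule has_field_derivative_transform_within_open[where S="{0<..}"])
        (use 3 in \<open>auto simp: sqpos_nonneg_arg\<close>)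
  next
    case 2
    have "((\<lambda>h. max h (0::real)) \<longlongrightarrow> max 0 0) (at 0)"
      by (intro tendsto_intros)
    then have "((\<lambda>h. max h (0::real)) \<longlongrightarrow> 0) (at 0)"
      by simp
    \<comment> \<open>At the kink the difference quotient is the positive part of \<open>h\<close>
      itself, which tends to \<open>0\<close>.\<close>
    moreover have "\<forall>\<^sub>F h in at 0. max h 0 = (sqpos (0 + h) - sqpos 0) / (h::real)"
      by (auto simp: sqpos_def max_def power2_eq_square eventually_at_filter)
    ultimately show ?thesis using 2
      by (auto simp: DERIV_def intro: Lim_transform_eventually)
  qed
qed

lemmas has_derivative_sqpos[derivative_intros] =
  has_real_derivative_sqpos[THEN DERIV_compose_FDERIV]

text \<open>\<open>A\<close> and \<open>B\<close> are Bernstein coefficients of two univariate quadratics; on the unit square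
  \<open>cell_spline A B\<close> is the \<open>C\<^sup>1\<close> criss-cross quadratic with the same values and gradients at
  the four corners as their tensor product.\<close>

definition cell_spline :: "(nat \<Rightarrow> real) \<Rightarrow> (nat \<Rightarrow> real) \<Rightarrow> real \<Rightarrow> real \<Rightarrow> real" where
  "cell_spline A B s t =
     A 1 * B 0 * (1 - t)\<^sup>2 + A 0 * B 1 * (1 - s)\<^sup>2 + A 1 * B 2 * t\<^sup>2 + A 2 * B 1 * s\<^sup>2
     + (A 0 * B 0 - A 1 * B 0 - A 0 * B 1) * sqpos (1 - s - t)
     + (A 2 * B 0 - A 1 * B 0 - A 2 * B 1) * sqpos (s - t)
     + (A 0 * B 2 - A 0 * B 1 - A 1 * B 2) * sqpos (t - s)
     + (A 2 * B 2 - A 1 * B 2 - A 2 * B 1) * sqpos (s + t - 1)"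

text \<open>The partial derivative of \<open>cell_spline A B s t\<close> in \<open>s\<close>. By the
  symmetry \<open>cell_spline_swap\<close>, the one in \<open>t\<close> is
  \<open>cell_ds B A t s\<close>.\<close>

definition cell_ds :: "(nat \<Rightarrow> real) \<Rightarrow> (nat \<Rightarrow> real) \<Rightarrow> real \<Rightarrow> real \<Rightarrow> real" where
  "cell_ds A B s t =
     2 * A 2 * B 1 * s - 2 * A 0 * B 1 * (1 - s)
     - (A 0 * B 0 - A 1 * B 0 - A 0 * B 1) * (2 * max (1 - s - t) 0)
     + (A 2 * B 0 - A 1 * B 0 - A 2 * B 1) * (2 * max (s - t) 0)
     - (A 0 * B 2 - A 0 * B 1 - A 1 * B 2) * (2 * max (t - s) 0)
     + (A 2 * B 2 - A 1 * B 2 - A 2 * B 1) * (2 * max (s + t - 1) 0)"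

lemma cell_spline_swap: "cell_spline A B s t = cell_spline B A t s"
proof -
  have "1 - t - s = 1 - s - t" "t + s - 1 = s + t - 1" by simp_all
  then show ?thesis by (simp only: cell_spline_def) (simp add: algebra_simps)
qed

text \<open>Every truncated square enters with weight \<open>-1\<close>, and the two belonging to
  the same diagonal add up to a full square.\<close>

lemma cell_spline_one: "cell_spline (\<lambda>_. 1) (\<lambda>_. 1) s t = 1"
proof -
  have "sqpos r + sqpos (- r) = r\<^sup>2" for r by (auto simp: sqpos_def max_def)
  from this[of "s - t"] this[of "1 - s - t"] show ?thesis
    by (simp add: cell_spline_def power2_eq_square algebra_simps)
qed

text \<open>Sorted by the products \<open>A k * B l\<close>, the spline is a combination of eight
  functions that are nonnegative on the unit square. Corner products multiply a truncated square;
  the others multiply a square minus two truncated squares, which is controlled by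
  \<open>key\<close>.\<close>

lemma cell_spline_nonneg:
  assumes "\<And>k. 0 \<le> A k" "\<And>k. 0 \<le> B k" "0 \<le> s" "s \<le> 1" "0 \<le> t" "t \<le> 1"
  shows "0 \<le> cell_spline A B s t"
proof -
  have key: "sqpos a + sqpos b \<le> w\<^sup>2" if "a \<le> w" "b \<le> w" "a + b \<le> w" "0 \<le> w" for a b w
  proof -
    have "sqpos a + sqpos b \<le> (max a 0 + max b 0)\<^sup>2"
      by (simp add: sqpos_def power2_sum)
    also have "\<dots> \<le> w\<^sup>2"
      using that by (intro power_mono) auto
    finally show ?thesis .
  qed
  have sq: "0 \<le> sqpos r" for r by (simp add: sqpos_def)
  have "cell_spline A B s t =
      A 0 * B 0 * sqpos (1 - s - t) + A 2 * B 0 * sqpos (s - t)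
    + A 0 * B 2 * sqpos (t - s) + A 2 * B 2 * sqpos (s + t - 1)
    + A 1 * B 0 * ((1 - t)\<^sup>2 - (sqpos (1 - s - t) + sqpos (s - t)))
    + A 0 * B 1 * ((1 - s)\<^sup>2 - (sqpos (1 - s - t) + sqpos (t - s)))
    + A 1 * B 2 * (t\<^sup>2 - (sqpos (t - s) + sqpos (s + t - 1)))
    + A 2 * B 1 * (s\<^sup>2 - (sqpos (s - t) + sqpos (s + t - 1)))"
    by (simp add: cell_spline_def algebra_simps)
  also have "\<dots> \<ge> 0"
    using assms key[of "1 - s - t" "1 - t" "s - t"] key[of "1 - s - t" "1 - s" "t - s"]
      key[of "t - s" t "s + t - 1"] key[of "s - t" s "s + t - 1"]
    by (intro add_nonneg_nonneg mult_nonneg_nonneg sq) auto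
  finally show ?thesis .
qed

lemma cell_spline_sum_left:
  "cell_spline (\<lambda>k. \<Sum>r\<in>R. w r * A r k) B s t = (\<Sum>r\<in>R. w r * cell_spline (A r) B s t)"
proof -
  let ?c = "\<lambda>k. cell_spline (\<lambda>l. if l = k then 1 else 0) B s t"
  have *: "cell_spline A B s t = A 0 * ?c 0 + A 1 * ?c 1 + A 2 * ?c 2" for A
    by (simp add: cell_spline_def algebra_simps)
  show ?thesis
    by (subst (1 2) *) (simp add: sum_distrib_right distrib_left sum.distrib mult.assoc)
qed

lemma cell_spline_sum_right:
  "cell_spline A (\<lambda>k. \<Sum>r\<in>R. w r * B r k) s t = (\<Sum>r\<in>R. w r * cell_spline A (B r) s t)"
  by (subst (1 2) cell_spline_swap) (rule cell_spline_sum_left)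

text \<open>On an edge the value and the tangential derivative are those of the tensor product, but
  the normal derivative is the linear interpolant of its corner values. All of them depend on the
  coefficients across the edge only through an end value and an end slope, so smoothness becomes a
  univariate matching condition.\<close>

lemma cell_edge:
  assumes "0 \<le> t" "t \<le> 1"
  shows "cell_spline A B 0 t = A 0 * (B 0 * (1 - t)\<^sup>2 + 2 * B 1 * t * (1 - t) + B 2 * t\<^sup>2)"
    and "cell_spline A B 1 t = A 2 * (B 0 * (1 - t)\<^sup>2 + 2 * B 1 * t * (1 - t) + B 2 * t\<^sup>2)"
    and "cell_ds A B 0 t = 2 * (A 1 - A 0) * (B 0 * (1 - t) + B 2 * t)"
    and "cell_ds A B 1 t = 2 * (A 2 - A 1) * (B 0 * (1 - t) + B 2 * t)"
    and "cell_ds B A t 0 = A 0 * (2 * (B 1 - B 0) * (1 - t) + 2 * (B 2 - B 1) * t)"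
    and "cell_ds B A t 1 = A 2 * (2 * (B 1 - B 0) * (1 - t) + 2 * (B 2 - B 1) * t)"
proof -
  have p: "max (1 - t) 0 = 1 - t" "max (- t) 0 = 0" "max t 0 = t" "max (t - 1) 0 = 0"
    using assms by auto
  show "cell_spline A B 0 t = A 0 * (B 0 * (1 - t)\<^sup>2 + 2 * B 1 * t * (1 - t) + B 2 * t\<^sup>2)"
    "cell_spline A B 1 t = A 2 * (B 0 * (1 - t)\<^sup>2 + 2 * B 1 * t * (1 - t) + B 2 * t\<^sup>2)"
    by (simp_all add: cell_spline_def sqpos_def p) (simp_all add: power2_eq_square algebra_simps)
  show "cell_ds A B 0 t = 2 * (A 1 - A 0) * (B 0 * (1 - t) + B 2 * t)"
    "cell_ds A B 1 t = 2 * (A 2 - A 1) * (B 0 * (1 - t) + B 2 * t)"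
    "cell_ds B A t 0 = A 0 * (2 * (B 1 - B 0) * (1 - t) + 2 * (B 2 - B 1) * t)"
    "cell_ds B A t 1 = A 2 * (2 * (B 1 - B 0) * (1 - t) + 2 * (B 2 - B 1) * t)"
    by (simp_all add: cell_ds_def p) (simp_all add: algebra_simps)
qed

lemma cell_zero:
  "cell_spline (\<lambda>_. 0) B s t = 0" "cell_ds (\<lambda>_. 0) B s t = 0" "cell_ds B (\<lambda>_. 0) s t = 0"
  by (simp_all add: cell_spline_def cell_ds_def)

lemma cell_spline_has_derivative:
  "((\<lambda>P. cell_spline A B (c * (fst P - a)) (d * (snd P - b))) has_derivative
     (\<lambda>V. V \<bullet> (c * cell_ds A B (c * (fst P - a)) (d * (snd P - b)),
               d * cell_ds B A (d * (snd P - b)) (c * (fst P - a))))) (at P)"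
proof -
  \<comment> \<open>Ordered rewriting with these permutative equations identifies the truncated
    arguments of \<open>cell_ds A B s t\<close> with those of
    \<open>cell_ds B A t s\<close>.\<close>
  have e: "1 - s - t = 1 - t - s" "s + t - 1 = t + s - 1" for s t :: real by simp_all
  show ?thesis
    unfolding cell_spline_def
    apply (rule derivative_eq_intros refl | simp only: e)+
    apply (rule ext)
    apply (simp add: cell_ds_def inner_prod_def)
    apply (simp add: e)
    apply (simp add: algebra_simps)
    done
qed

subsection \<open>Existence of the classical B-splines\<close>

text \<open>\<open>node_weight u i p\<close> is the value at \<open>u p\<close>, and \<open>bern u i p\<close> the Bernstein coefficients on
  \<open>[u (p - 1), u p]\<close>, of the univariate quadratic B-spline supported on \<open>[u (i - 2), u (i + 1)]\<close>.\<close>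

definition node_weight :: "(int \<Rightarrow> real) \<Rightarrow> int \<Rightarrow> int \<Rightarrow> real" where
  "node_weight u i p =
     (if p = i then stp u (i + 1) / (stp u i + stp u (i + 1))
      else if p = i - 1 then stp u (i - 1) / (stp u (i - 1) + stp u i) else 0)"

definition bern :: "(int \<Rightarrow> real) \<Rightarrow> int \<Rightarrow> int \<Rightarrow> nat \<Rightarrow> real" where
  "bern u i p k =
     (if k = 0 then node_weight u i (p - 1) else if k = 1 then (if p = i then 1 else 0)
      else node_weight u i p)"

text \<open>The scaling is a left factor so that \<open>cell_spline_has_derivative\<close> matches
  after unfolding.\<close>

definition loc :: "(int \<Rightarrow> real) \<Rightarrow> int \<Rightarrow> real \<Rightarrow> real" where
  "loc u p x = 1 / stp u p * (x - u (p - 1))"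

type_synonym profile = "(nat \<Rightarrow> real) \<times> real \<times> real"

text \<open>The third component is the derivative of the second, the chain-rule factor in
  \<open>cell_jet\<close>.\<close>

definition profile :: "(int \<Rightarrow> real) \<Rightarrow> int \<Rightarrow> int \<Rightarrow> real \<Rightarrow> profile" where
  "profile u i p x = (bern u i p, loc u p x, 1 / stp u p)"

definition cell_jet :: "profile \<Rightarrow> profile \<Rightarrow> real \<times> real \<times> real" where
  "cell_jet = (\<lambda>(A, s, a) (B, t, b).
     (cell_spline A B s t, a * cell_ds A B s t, b * cell_ds B A t s))"

text \<open>The formulas of \<open>cell_edge\<close> need a local coordinate in the unit interval.
  In the unbounded outer slabs it may leave that interval, but there the coefficients
  vanish.\<close>

definition admissible :: "profile \<Rightarrow> bool" where
  "admissible = (\<lambda>(A, s, a). A = (\<lambda>_. 0) \<or> 0 \<le> s \<and> s \<le> 1)"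

text \<open>For \<open>p\<close> from \<open>i - 2\<close> to \<open>i + 2\<close> these are five
  closed sets covering the line. The two half-lines lie outside the support, so the construction
  reaches the whole plane.\<close>

definition slab :: "(int \<Rightarrow> real) \<Rightarrow> int \<Rightarrow> int \<Rightarrow> real set" where
  "slab u i p = (if p \<le> i - 2 then {..u (i - 2)} else if p \<ge> i + 2 then {u (i + 1)..}
     else {u (p - 1)..u p})"

definition slab_index :: "(int \<Rightarrow> real) \<Rightarrow> int \<Rightarrow> real \<Rightarrow> int" where
  "slab_index u i x = (if x \<le> u (i - 2) then i - 2 else if x \<le> u (i - 1) then i - 1
     else if x \<le> u i then i else if x \<le> u (i + 1) then i + 1 else i + 2)"

definition bspline_jet ::
  "(int \<Rightarrow> real) \<Rightarrow> (int \<Rightarrow> real) \<Rightarrow> int \<Rightarrow> int \<Rightarrow> real \<times> real \<Rightarrow> real \<times> real \<times> real" where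
  "bspline_jet u v i j = (\<lambda>(x, y).
     cell_jet (profile u i (slab_index u i x) x) (profile v j (slab_index v j y) y))"

lemma cell_jet_swap: "cell_jet q p = (case cell_jet p q of (f, a, b) \<Rightarrow> (f, b, a))"
  by (cases p; cases q) (simp add: cell_jet_def cell_spline_swap)

lemma bern_eq_0: "p \<le> i - 2 \<or> i + 2 \<le> p \<Longrightarrow> bern u i p = (\<lambda>_. 0)"
  by (auto simp: bern_def node_weight_def fun_eq_iff)

lemma int_range5:
  "p \<in> {i - 2..i + 2} \<longleftrightarrow> p = i - 2 \<or> p = i - 1 \<or> p = i \<or> p = i + 1 \<or> p = i + (2::int)"
  by auto

section \<open>Matching of value and gradient across a knot\<close>

context
  fixes u :: "int \<Rightarrow> real" and i :: int
  assumes inc: "u (i - 2) < u (i - 1)" "u (i - 1) < u i" "u i < u (i + 1)"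
begin

lemma stp_pos: "0 < stp u (i - 1)" "0 < stp u i" "0 < stp u (i + 1)"
  using inc by (simp_all add: stp_def)

lemma stp_pos': "p \<in> {i - 1..i + 1} \<Longrightarrow> 0 < stp u p"
proof -
  assume "p \<in> {i - 1..i + 1}"
  then have "p = i - 1 \<or> p = i \<or> p = i + 1" by auto
  then show ?thesis using stp_pos by auto
qed

lemma slab_index: "slab_index u i x \<in> {i - 2..i + 2}" "x \<in> slab u i (slab_index u i x)"
  by (auto simp: slab_index_def slab_def)

lemma loc_bounds: "p \<in> {i - 1..i + 1} \<Longrightarrow> x \<in> slab u i p \<Longrightarrow> 0 \<le> loc u p x \<and> loc u p x \<le> 1"
  using stp_pos'[of p] by (auto simp: loc_def slab_def field_simps) (auto simp: stp_def)

lemma admissible_profile: "x \<in> slab u i p \<Longrightarrow> admissible (profile u i p x)"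
  using bern_eq_0[of p i] loc_bounds[of p x]
  by (cases "p \<in> {i - 1..i + 1}") (auto simp: admissible_def profile_def)

lemma cell_jet_right_end:
  assumes "p \<in> {i - 1..i + 1}" "0 \<le> t" "t \<le> 1"
  shows "cell_jet (profile u i p (u p)) (B, t, b) =
    (node_weight u i p * (B 0 * (1 - t)\<^sup>2 + 2 * B 1 * t * (1 - t) + B 2 * t\<^sup>2),
     2 * ((node_weight u i p - bern u i p 1) / stp u p) * (B 0 * (1 - t) + B 2 * t),
     b * (node_weight u i p * (2 * (B 1 - B 0) * (1 - t) + 2 * (B 2 - B 1) * t)))"
proof -
  have "loc u p (u p) = 1" using stp_pos'[OF assms(1)] by (simp add: loc_def stp_def)
  then show ?thesis
    by (simp add: cell_jet_def profile_def cell_edge[OF assms(2,3)] bern_def)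
qed

lemma cell_jet_left_end:
  assumes "0 \<le> t" "t \<le> 1"
  shows "cell_jet (profile u i (p + 1) (u p)) (B, t, b) =
    (node_weight u i p * (B 0 * (1 - t)\<^sup>2 + 2 * B 1 * t * (1 - t) + B 2 * t\<^sup>2),
     2 * ((bern u i (p + 1) 1 - node_weight u i p) / stp u (p + 1)) * (B 0 * (1 - t) + B 2 * t),
     b * (node_weight u i p * (2 * (B 1 - B 0) * (1 - t) + 2 * (B 2 - B 1) * t)))"
proof -
  have "loc u (p + 1) (u p) = 0" by (simp add: loc_def)
  then show ?thesis
    by (simp add: cell_jet_def profile_def cell_edge[OF assms] bern_def)
qed

text \<open>By the two end formulas, the jets on the two sides of an inner knot can differ only
  through their one-sided slopes, and these agree. At both ends of the support one side has zero
  coefficients, and value and slope of the other side vanish.\<close>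

lemma cell_jet_match:
  assumes "p \<in> {i - 2..i + 1}" "admissible r"
  shows "cell_jet (profile u i p (u p)) r = cell_jet (profile u i (p + 1) (u p)) r"
proof -
  obtain B t b where r: "r = (B, t, b)" by (cases r)
  show ?thesis
  proof (cases "B = (\<lambda>_. 0)")
    case True
    then show ?thesis by (simp add: r cell_jet_def profile_def cell_zero cell_spline_swap[of _ "\<lambda>_. 0"])
  next
    case False
    then have t: "0 \<le> t" "t \<le> 1" using assms(2) by (auto simp: r admissible_def)
    note left = cell_jet_left_end[OF t, of p B b] and right = cell_jet_right_end[OF _ t, of p B b]
    consider "p = i - 2" | "p = i - 1" | "p = i" | "p = i + 1" using assms(1) by force
    then show ?thesis
    proof cases
      case 1
      then have "node_weight u i p = 0" "bern u i (p + 1) 1 = 0" "bern u i p = (\<lambda>_. 0)"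
        by (auto simp: node_weight_def bern_def bern_eq_0)
      with left show ?thesis by (simp add: r) (simp add: cell_jet_def profile_def cell_zero)
    next
      case 2
      \<comment> \<open>Half of the univariate slopes on the two sides of \<open>u (i - 1)\<close>,
        where the value is \<open>a / (a + b)\<close> for the adjacent steps \<open>a\<close> and
        \<open>b\<close>.\<close>
      have "a / (a + b) / a = (1 - a / (a + b)) / b" if "0 < a" "0 < b" for a b :: real
        using that by (simp add: divide_simps)
      from this[of "stp u (i - 1)" "stp u i"]
      have slope: "(node_weight u i p - bern u i p 1) / stp u p
          = (bern u i (p + 1) 1 - node_weight u i p) / stp u (p + 1)"
        using stp_pos by (simp add: 2 node_weight_def bern_def)
      have "p \<in> {i - 1..i + 1}" by (simp add: 2)
      then show ?thesis by (simp only: r left right slope)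
    next
      case 3
      have "(b / (a + b) - 1) / a = - (b / (a + b)) / b" if "0 < a" "0 < b" for a b :: real
        using that by (simp add: divide_simps)
      from this[of "stp u i" "stp u (i + 1)"]
      have slope: "(node_weight u i p - bern u i p 1) / stp u p
          = (bern u i (p + 1) 1 - node_weight u i p) / stp u (p + 1)"
        using stp_pos by (simp add: 3 node_weight_def bern_def)
      have "p \<in> {i - 1..i + 1}" by (simp add: 3)
      then show ?thesis by (simp only: r left right slope)
    next
      case 4
      then have "node_weight u i p = 0" "bern u i p 1 = 0" "bern u i (p + 1) = (\<lambda>_. 0)"
        by (auto simp: node_weight_def bern_def bern_eq_0)
      with right 4 show ?thesis by (simp add: r) (simp add: cell_jet_def profile_def cell_zero)
    qed
  qed
qed

lemma cell_jet_slab: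
  assumes "p \<in> {i - 2..i + 2}" "x \<in> slab u i p" "admissible r"
  shows "cell_jet (profile u i (slab_index u i x) x) r = cell_jet (profile u i p x) r"
proof -
  \<comment> \<open>At a knot shared by two slabs \<open>slab_index\<close> picks the left one. The
    indices can thus differ only at the left end of slab \<open>p\<close>, where
    \<open>cell_jet_match\<close> applies.\<close>
  have "slab_index u i x = p \<or> (slab_index u i x = p - 1 \<and> x = u (p - 1))"
    using assms(1,2) inc unfolding int_range5
    by (elim disjE) (auto simp: slab_def slab_index_def algebra_simps)
  then show ?thesis
    using cell_jet_match[of "p - 1" r] assms slab_index(1)[of x] by auto
qed

end

section \<open>The global C1 function assembled from its cells\<close>

locale bspline_knots =
  fixes u v :: "int \<Rightarrow> real" and i j :: int
  assumes uinc: "u (i - 2) < u (i - 1)" "u (i - 1) < u i" "u i < u (i + 1)"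
    and vinc: "v (j - 2) < v (j - 1)" "v (j - 1) < v j" "v j < v (j + 1)"
begin

text \<open>At a knot either adjacent slab may be used. This is proved one variable at a time, with
  \<open>cell_jet_swap\<close> transferring the univariate statement to the second variable.\<close>

lemma bspline_jet_eq:
  assumes "p \<in> {i - 2..i + 2}" "x \<in> slab u i p" "q \<in> {j - 2..j + 2}" "y \<in> slab v j q"
  shows "bspline_jet u v i j (x, y) = cell_jet (profile u i p x) (profile v j q y)"
proof -
  have "bspline_jet u v i j (x, y) = cell_jet (profile u i p x) (profile v j (slab_index v j y) y)"
    unfolding bspline_jet_def prod.case
    by (intro cell_jet_slab[OF uinc] assms admissible_profile[OF vinc] slab_index[OF vinc])
  also have "\<dots> = cell_jet (profile u i p x) (profile v j q y)"
    using cell_jet_slab[OF vinc assms(3,4) admissible_profile[OF uinc assms(2)]]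
    by (subst (1 2) cell_jet_swap) simp
  finally show ?thesis .
qed

lemma fst_bspline_jet_eq:
  assumes "p \<in> {i - 2..i + 2}" "x \<in> slab u i p" "q \<in> {j - 2..j + 2}" "y \<in> slab v j q"
  shows "fst (bspline_jet u v i j (x, y)) = cell_spline (bern u i p) (bern v j q) (loc u p x) (loc v q y)"
  by (simp add: bspline_jet_eq[OF assms] cell_jet_def profile_def)

text \<open>Each of the 25 products of slabs is closed and carries a formula that is C1 on the whole
  plane. By \<open>bspline_jet_eq\<close> they are restrictions of one function, so they
  glue.\<close>

lemma jet_on_bspline_jet: "jet_on UNIV (bspline_jet u v i j)"
proof -
  let ?I = "{i - 2..i + 2} \<times> {j - 2..j + 2}"
  let ?S = "\<lambda>(p, q). slab u i p \<times> slab v j q"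
  have "jet_on (\<Union>k\<in>?I. ?S k) (bspline_jet u v i j)"
  proof (rule jet_on_UNION)
    show "finite ?I" by simp
    show "closed (?S k)" for k
      by (cases k) (auto simp: slab_def intro!: closed_Times)
    fix k assume k: "k \<in> ?I"
    obtain p q where pq: "k = (p, q)" by (cases k)
    have "jet_on UNIV (\<lambda>P. cell_jet (profile u i p (fst P)) (profile v j q (snd P)))"
      unfolding jet_on_def
    proof (intro conjI ballI)
      show "continuous_on UNIV (\<lambda>P. cell_jet (profile u i p (fst P)) (profile v j q (snd P)))"
        unfolding cell_jet_def profile_def loc_def prod.case cell_spline_def cell_ds_def sqpos_def
        by (intro continuous_intros)
      show "((\<lambda>P. fst (cell_jet (profile u i p (fst P)) (profile v j q (snd P)))) has_derivative
          (\<lambda>V. V \<bullet> snd (cell_jet (profile u i p (fst P)) (profile v j q (snd P))))) (at P)" for P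
        unfolding cell_jet_def profile_def loc_def prod.case fst_conv snd_conv
        by (rule cell_spline_has_derivative)
    qed
    then show "jet_on (?S k) (bspline_jet u v i j)"
      using k by (auto simp: pq bspline_jet_eq intro: jet_on_cong[OF jet_on_subset])
  qed
  moreover have "(\<Union>k\<in>?I. ?S k) = UNIV"
    using slab_index[OF uinc] slab_index[OF vinc] by (fastforce simp: Bex_def)
  ultimately show ?thesis by simp
qed

end

section \<open>Quadratic pieces on the triangles\<close>

definition affine_fun :: "(real \<times> real \<Rightarrow> real) \<Rightarrow> bool" where
  "affine_fun l \<longleftrightarrow> (\<exists>a b c. \<forall>P. l P = a * fst P + b * snd P + c)"

lemma affine_funI: "(\<And>P. l P = a * fst P + b * snd P + c) \<Longrightarrow> affine_fun l"
  unfolding affine_fun_def by blast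

lemma affine_fun_intros:
  "affine_fun fst" "affine_fun snd" "affine_fun (\<lambda>_. c)"
  "affine_fun l \<Longrightarrow> affine_fun l' \<Longrightarrow> affine_fun (\<lambda>P. l P + l' P)"
  "affine_fun l \<Longrightarrow> affine_fun l' \<Longrightarrow> affine_fun (\<lambda>P. l P - l' P)"
  "affine_fun l \<Longrightarrow> affine_fun (\<lambda>P. c * l P)"
proof -
  show "affine_fun fst" by (rule affine_funI[of _ 1 0 0]) simp
  show "affine_fun snd" by (rule affine_funI[of _ 0 1 0]) simp
  show "affine_fun (\<lambda>_. c)" by (rule affine_funI[of _ 0 0 c]) simp
  {
    assume "affine_fun l" "affine_fun l'"
    then obtain a b c a' b' c' where "\<And>P. l P = a * fst P + b * snd P + c"
      "\<And>P. l' P = a' * fst P + b' * snd P + c'" unfolding affine_fun_def by blast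
    then have "l P + l' P = (a + a') * fst P + (b + b') * snd P + (c + c')"
      "l P - l' P = (a - a') * fst P + (b - b') * snd P + (c - c')" for P
      by (simp_all add: algebra_simps)
    then show "affine_fun (\<lambda>P. l P + l' P)" "affine_fun (\<lambda>P. l P - l' P)"
      by (auto intro: affine_funI)
  }
  show "affine_fun (\<lambda>P. c * l P)" if "affine_fun l"
  proof -
    from that obtain a b d where "\<And>P. l P = a * fst P + b * snd P + d"
      unfolding affine_fun_def by blast
    then show ?thesis
      by (intro affine_funI[of _ "c * a" "c * b" "c * d"]) (simp add: algebra_simps)
  qed
qed

lemma affine_fun_nonneg_hull:
  assumes "affine_fun l" "\<And>P. P \<in> V \<Longrightarrow> 0 \<le> l P" "P \<in> convex hull V"
  shows "0 \<le> l P"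
proof -
  obtain a b c where l: "\<And>P. l P = a * fst P + b * snd P + c"
    using assms(1) unfolding affine_fun_def by blast
  have "{P. 0 \<le> l P} = {P. (a, b) \<bullet> P \<ge> - c}"
    by (auto simp: l inner_prod_def)
  then have "convex {P. 0 \<le> l P}" by (simp add: convex_halfspace_ge)
  then have "convex hull V \<subseteq> {P. 0 \<le> l P}" using assms(2) by (intro hull_minimal) auto
  then show ?thesis using assms(3) by auto
qed

lemma quadratic_onI:
  assumes "\<And>s t. (s, t) \<in> T \<Longrightarrow> g (s, t) = c0 + c1 * s + c2 * t + c3 * s\<^sup>2 + c4 * s * t + c5 * t\<^sup>2"
  shows "quadratic_on T g"
  unfolding quadratic_on_def by (rule exI)+ (use assms in auto)

lemma quadratic_on_cong: "quadratic_on T f \<Longrightarrow> (\<And>P. P \<in> T \<Longrightarrow> f P = g P) \<Longrightarrow> quadratic_on T g"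
  unfolding quadratic_on_def by (elim ex_forward) auto

lemma quadratic_on_0: "quadratic_on T (\<lambda>_. 0)"
  unfolding quadratic_on_def by (rule exI[of _ 0])+ simp

lemma quadratic_on_add:
  assumes "quadratic_on T f" "quadratic_on T g"
  shows "quadratic_on T (\<lambda>P. f P + g P)"
proof -
  obtain a0 a1 a2 a3 a4 a5 where
    "\<forall>(s, t)\<in>T. f (s, t) = a0 + a1 * s + a2 * t + a3 * s\<^sup>2 + a4 * s * t + a5 * t\<^sup>2"
    using assms(1) unfolding quadratic_on_def by (elim exE)
  moreover obtain b0 b1 b2 b3 b4 b5 where
    "\<forall>(s, t)\<in>T. g (s, t) = b0 + b1 * s + b2 * t + b3 * s\<^sup>2 + b4 * s * t + b5 * t\<^sup>2"
    using assms(2) unfolding quadratic_on_def by (elim exE)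
  ultimately show ?thesis
    by (intro quadratic_onI[of _ _ "a0 + b0" "a1 + b1" "a2 + b2" "a3 + b3" "a4 + b4" "a5 + b5"])
      (drule (1) bspec, drule (1) bspec, simp add: algebra_simps)
qed

lemma quadratic_on_cmult:
  assumes "quadratic_on T f"
  shows "quadratic_on T (\<lambda>P. c * f P)"
proof -
  obtain a0 a1 a2 a3 a4 a5 where
    "\<forall>(s, t)\<in>T. f (s, t) = a0 + a1 * s + a2 * t + a3 * s\<^sup>2 + a4 * s * t + a5 * t\<^sup>2"
    using assms unfolding quadratic_on_def by (elim exE)
  then show ?thesis
    by (intro quadratic_onI[of _ _ "c * a0" "c * a1" "c * a2" "c * a3" "c * a4" "c * a5"])
      (drule (1) bspec, simp add: algebra_simps)
qed

lemma quadratic_on_square: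
  assumes "affine_fun l"
  shows "quadratic_on T (\<lambda>P. (l P)\<^sup>2)"
proof -
  obtain a b c where l: "\<And>P. l P = a * fst P + b * snd P + c"
    using assms unfolding affine_fun_def by blast
  then show ?thesis
    by (intro quadratic_onI[of _ _ "c\<^sup>2" "2 * a * c" "2 * b * c" "a\<^sup>2" "2 * a * b" "b\<^sup>2"]) (auto simp: power2_eq_square algebra_simps)
qed

lemma quadratic_on_sqpos:
  assumes "affine_fun l" "(\<forall>P\<in>T. 0 \<le> l P) \<or> (\<forall>P\<in>T. l P \<le> 0)"
  shows "quadratic_on T (\<lambda>P. sqpos (l P))"
  using assms(2)
proof
  assume "\<forall>P\<in>T. 0 \<le> l P"
  then show ?thesis
    by (intro quadratic_on_cong[OF quadratic_on_square[OF assms(1)]]) (simp add: sqpos_nonneg_arg)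
next
  assume "\<forall>P\<in>T. l P \<le> 0"
  then show ?thesis
    by (intro quadratic_on_cong[OF quadratic_on_0]) (simp add: sqpos_nonpos_arg)
qed

lemma affine_fun_loc:
  "affine_fun (\<lambda>P. loc u p (fst P))" "affine_fun (\<lambda>P. loc u p (snd P))"
  unfolding loc_def by (intro affine_fun_intros)+

text \<open>In local coordinates the diagonals are \<open>s = t\<close> and
  \<open>s + t = 1\<close>. The sign of an affine function on a triangle follows from its vertices,
  so on each triangle every truncated square reduces to a square or to zero.\<close>

lemma cell_triangle_signs:
  assumes "u (p - 1) < u p" "v (q - 1) < v q" "T \<in> cell_triangles u v p q"
  defines "s \<equiv> \<lambda>P. loc u p (fst P)" and "t \<equiv> \<lambda>P. loc v q (snd P)"
  shows "(\<forall>P\<in>T. 0 \<le> s P - t P) \<or> (\<forall>P\<in>T. s P - t P \<le> 0)"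
    and "(\<forall>P\<in>T. 0 \<le> 1 - s P - t P) \<or> (\<forall>P\<in>T. 1 - s P - t P \<le> 0)"
    and "T \<subseteq> {u (p - 1)..u p} \<times> {v (q - 1)..v q}"
proof -
  have l: "loc u p (u (p - 1)) = 0" "loc u p (u p) = 1" "loc u p (mid u p) = 1 / 2"
    "loc v q (v (q - 1)) = 0" "loc v q (v q) = 1" "loc v q (mid v q) = 1 / 2"
    using assms(1,2) by (auto simp: loc_def mid_def stp_def field_simps)
  have m: "u (p - 1) \<le> mid u p" "mid u p \<le> u p" "v (q - 1) \<le> mid v q" "mid v q \<le> v q"
    using assms(1,2) by (auto simp: mid_def)
  have aff: "affine_fun (\<lambda>P. s P - t P)" "affine_fun (\<lambda>P. t P - s P)"
    "affine_fun (\<lambda>P. 1 - s P - t P)" "affine_fun (\<lambda>P. s P + t P - 1)"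
    unfolding s_def t_def by (intro affine_fun_intros affine_fun_loc)+
  obtain V where T: "T = convex hull V" and V: "V \<in> {{(mid u p, mid v q), (u (p - 1), v (q - 1)), (u p, v (q - 1))},
    {(mid u p, mid v q), (u p, v (q - 1)), (u p, v q)},
    {(mid u p, mid v q), (u p, v q), (u (p - 1), v q)},
    {(mid u p, mid v q), (u (p - 1), v q), (u (p - 1), v (q - 1))}}"
    using assms(3) unfolding cell_triangles_def Let_def by blast
  have "(\<forall>P\<in>V. 0 \<le> s P - t P) \<or> (\<forall>P\<in>V. 0 \<le> t P - s P)"
    using V by (auto simp: s_def t_def l)
  then show "(\<forall>P\<in>T. 0 \<le> s P - t P) \<or> (\<forall>P\<in>T. s P - t P \<le> 0)"
    using affine_fun_nonneg_hull[OF aff(1), of V] affine_fun_nonneg_hull[OF aff(2), of V]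
    unfolding T by force
  have "(\<forall>P\<in>V. 0 \<le> 1 - s P - t P) \<or> (\<forall>P\<in>V. 0 \<le> s P + t P - 1)"
    using V by (auto simp: s_def t_def l)
  then show "(\<forall>P\<in>T. 0 \<le> 1 - s P - t P) \<or> (\<forall>P\<in>T. 1 - s P - t P \<le> 0)"
    using affine_fun_nonneg_hull[OF aff(3), of V] affine_fun_nonneg_hull[OF aff(4), of V]
    unfolding T by force
  have "V \<subseteq> {u (p - 1)..u p} \<times> {v (q - 1)..v q}"
    using V m assms(1,2) by auto
  then show "T \<subseteq> {u (p - 1)..u p} \<times> {v (q - 1)..v q}"
    unfolding T by (intro hull_minimal convex_Times) auto
qed

lemma quadratic_on_cell_spline:
  assumes "u (p - 1) < u p" "v (q - 1) < v q" "T \<in> cell_triangles u v p q"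
  shows "quadratic_on T (\<lambda>P. cell_spline A B (loc u p (fst P)) (loc v q (snd P)))"
proof -
  note sg = cell_triangle_signs(1,2)[OF assms]
  let ?s = "\<lambda>P. loc u p (fst P)" and ?t = "\<lambda>P. loc v q (snd P)"
  have "0 \<le> ?s P - ?t P \<longleftrightarrow> ?t P - ?s P \<le> 0" "?s P - ?t P \<le> 0 \<longleftrightarrow> 0 \<le> ?t P - ?s P"
    "0 \<le> 1 - ?s P - ?t P \<longleftrightarrow> ?s P + ?t P - 1 \<le> 0" "1 - ?s P - ?t P \<le> 0 \<longleftrightarrow> 0 \<le> ?s P + ?t P - 1" for P
    by linarith+
  with sg have *: "(\<forall>P\<in>T. 0 \<le> ?t P - ?s P) \<or> (\<forall>P\<in>T. ?t P - ?s P \<le> 0)"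
    "(\<forall>P\<in>T. 0 \<le> ?s P + ?t P - 1) \<or> (\<forall>P\<in>T. ?s P + ?t P - 1 \<le> 0)"
    by blast+
  show ?thesis
    unfolding cell_spline_def
    by (intro quadratic_on_add quadratic_on_cmult quadratic_on_square quadratic_on_sqpos
        affine_fun_intros affine_fun_loc sg *)
qed

section \<open>Support in the octagon\<close>

lemma rectangle_in_convex:
  fixes C :: "(real \<times> real) set"
  assumes "convex C" "(a, c) \<in> C" "(b, c) \<in> C" "(a, d) \<in> C" "(b, d) \<in> C"
    "a \<le> x" "x \<le> b" "c \<le> y" "y \<le> d"
  shows "(x, y) \<in> C"
proof -
  have h: "(x, z) \<in> C" if "(a, z) \<in> C" "(b, z) \<in> C" for z
  proof -
    have "x \<in> closed_segment a b" using assms by (simp add: closed_segment_eq_real_ivl)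
    then obtain r where r: "0 \<le> r" "r \<le> 1" "x = (1 - r) * a + r * b"
      by (auto simp: closed_segment_def)
    then have "(x, z) = (1 - r) *\<^sub>R (a, z) + r *\<^sub>R (b, z)" by (simp add: algebra_simps)
    then show ?thesis using convexD_alt[OF assms(1) that] r by metis
  qed
  have "y \<in> closed_segment c d" using assms by (simp add: closed_segment_eq_real_ivl)
  then obtain r where r: "0 \<le> r" "r \<le> 1" "y = (1 - r) * c + r * d"
    by (auto simp: closed_segment_def)
  then have "(x, y) = (1 - r) *\<^sub>R (x, c) + r *\<^sub>R (x, d)" by (simp add: algebra_simps)
  then show ?thesis using convexD_alt[OF assms(1) h[OF assms(2,3)] h[OF assms(4,5)]] r by metis
qed

lemma triangle_in_convex:
  fixes C :: "(real \<times> real) set"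
  assumes "convex C" "(a, c) \<in> C" "(b, c) \<in> C" "(a, d) \<in> C" "0 \<le> s" "0 \<le> t" "s + t \<le> 1"
    "x = a + s * (b - a)" "y = c + t * (d - c)"
  shows "(x, y) \<in> C"
proof -
  have "(x, y) = (1 - s - t) *\<^sub>R (a, c) + s *\<^sub>R (b, c) + t *\<^sub>R (a, d)"
    using assms by (simp add: algebra_simps)
  also have "\<dots> \<in> convex hull {(a, c), (b, c), (a, d)}"
    unfolding convex_hull_3
    by (rule CollectI, rule exI[of _ "1 - s - t"], rule exI[of _ s], rule exI[of _ t])
      (use assms(5-7) in auto)
  also have "\<dots> \<subseteq> C" using assms(1-4) by (intro hull_minimal) auto
  finally show ?thesis .
qed

context bspline_knots begin

lemma octagon_vertices:
  "(u (i - 2), v (j - 1)) \<in> octagon u v i j" "(u (i - 2), v j) \<in> octagon u v i j"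
  "(u (i - 1), v (j + 1)) \<in> octagon u v i j" "(u i, v (j + 1)) \<in> octagon u v i j"
  "(u (i + 1), v j) \<in> octagon u v i j" "(u (i + 1), v (j - 1)) \<in> octagon u v i j"
  "(u i, v (j - 2)) \<in> octagon u v i j" "(u (i - 1), v (j - 2)) \<in> octagon u v i j"
  unfolding octagon_def by (auto intro: hull_inc)

lemma convex_octagon: "convex (octagon u v i j)"
  unfolding octagon_def by simp

text \<open>The four points lie on the two vertical chords joining bottom to top vertices; the
  rectangle lemma is applied with width zero.\<close>

lemma octagon_inner:
  "(u (i - 1), v (j - 1)) \<in> octagon u v i j" "(u (i - 1), v j) \<in> octagon u v i j"
  "(u i, v (j - 1)) \<in> octagon u v i j" "(u i, v j) \<in> octagon u v i j"
  using rectangle_in_convex[OF convex_octagon octagon_vertices(8,8,3,3)]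
    rectangle_in_convex[OF convex_octagon octagon_vertices(7,7,4,4)] vinc by auto

lemma octagon_subset: "octagon u v i j \<subseteq> {u (i - 2)..u (i + 1)} \<times> {v (j - 2)..v (j + 1)}"
  unfolding octagon_def using uinc vinc by (intro hull_minimal convex_Times) auto

text \<open>The octagon contains the five cells of the central cross and half of each of the four
  corner cells. In a corner cell only one coefficient product survives, and its truncated square
  vanishes beyond the diagonal bounding the octagon.\<close>

lemma bspline_jet_outside:
  assumes "fst (bspline_jet u v i j (x, y)) \<noteq> 0"
  shows "(x, y) \<in> octagon u v i j"
proof -
  define p q where "p = slab_index u i x" and "q = slab_index v j y"
  define s t where "s = loc u p x" and "t = loc v q y"
  note p = slab_index[OF uinc, of x, folded p_def] and q = slab_index[OF vinc, of y, folded q_def]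
  have val: "cell_spline (bern u i p) (bern v j q) s t \<noteq> 0"
    using assms fst_bspline_jet_eq[OF p q] by (simp add: s_def t_def)
  have "p \<noteq> i - 2" "p \<noteq> i + 2" "q \<noteq> j - 2" "q \<noteq> j + 2"
    using val by (auto simp: bern_eq_0 cell_zero cell_spline_swap[of _ "\<lambda>_. 0"])
  then have pc: "p = i - 1 \<or> p = i \<or> p = i + 1" and qc: "q = j - 1 \<or> q = j \<or> q = j + 1"
    using p(1) q(1) by auto
  have st: "0 \<le> s" "s \<le> 1" "0 \<le> t" "t \<le> 1"
    using loc_bounds[OF uinc _ p(2)] loc_bounds[OF vinc _ q(2)] pc qc by (auto simp: s_def t_def)
  have x: "u (p - 1) \<le> x" "x \<le> u p" "x = u (p - 1) + s * (u p - u (p - 1))"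
    "x = u p + (1 - s) * (u (p - 1) - u p)"
    using p(2) pc stp_pos[OF uinc] by (auto simp: slab_def s_def loc_def stp_def field_simps)
  have y: "v (q - 1) \<le> y" "y \<le> v q" "y = v (q - 1) + t * (v q - v (q - 1))"
    "y = v q + (1 - t) * (v (q - 1) - v q)"
    using q(2) qc stp_pos[OF vinc] by (auto simp: slab_def t_def loc_def stp_def field_simps)
  note rect = rectangle_in_convex[OF convex_octagon _ _ _ _ x(1,2) y(1,2)]
  note oct = octagon_vertices octagon_inner
  show ?thesis
  proof (cases "p = i \<or> q = j")
    case True
    then show ?thesis using pc qc oct by (intro rect) (auto simp: algebra_simps)
  next
    case False
    then consider "p = i + 1" "q = j + 1" | "p = i + 1" "q = j - 1"
      | "p = i - 1" "q = j + 1" | "p = i - 1" "q = j - 1" using pc qc by blast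
    then show ?thesis
    proof cases
      case 1
      \<comment> \<open>Only the term with \<open>A 0 * B 0 * sqpos (1 - s - t)\<close> survives;
        the other three corners are its reflections.\<close>
      with val have "s + t \<le> 1"
        by (force simp: cell_spline_def bern_def node_weight_def sqpos_def)
      with 1 st x y show ?thesis
        using triangle_in_convex[OF convex_octagon, of "u i" "v j" "u (i + 1)" "v (j + 1)" s t x y] oct
        by simp
    next
      case 2
      with val have "s + (1 - t) \<le> 1"
        by (force simp: cell_spline_def bern_def node_weight_def sqpos_def)
      with 2 st x y show ?thesis
        using triangle_in_convex[OF convex_octagon, of "u i" "v (j - 1)" "u (i + 1)" "v (j - 2)" s "1 - t" x y] oct
        by simp
    next
      case 3
      with val have "(1 - s) + t \<le> 1"
        by (force simp: cell_spline_def bern_def node_weight_def sqpos_def)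
      with 3 st x y show ?thesis
        using triangle_in_convex[OF convex_octagon, of "u (i - 1)" "v j" "u (i - 2)" "v (j + 1)" "1 - s" t x y] oct
        by simp
    next
      case 4
      with val have "(1 - s) + (1 - t) \<le> 1"
        by (force simp: cell_spline_def bern_def node_weight_def sqpos_def)
      with 4 st x y show ?thesis
        using triangle_in_convex[OF convex_octagon, of "u (i - 1)" "v (j - 1)" "u (i - 2)" "v (j - 2)" "1 - s" "1 - t" x y] oct
        by simp
    qed
  qed
qed

end

section \<open>Cells of the extended grid\<close>

lemma extended_knots_less:
  assumes "is_extended_knots m x u" "-2 \<le> p" "p < q" "q \<le> m + 2"
  shows "u p < u q"
proof -
  have succ: "u r < u (r + 1)" if "-2 \<le> r" "r \<le> m + 1" for r
  proof -
    have "r + 1 \<in> {- 1..m + 2}" using that by simp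
    then have "u (r + 1 - 1) < u (r + 1)" using assms(1) unfolding is_extended_knots_def by blast
    then show ?thesis by simp
  qed
  from assms(3,4) show ?thesis
  proof (induction q rule: int_gr_induct)
    case base
    then show ?case using succ[of p] assms(2) by simp
  next
    case (step r)
    then show ?case using succ[of r] assms(2) by simp
  qed
qed

lemma extended_knots_le:
  assumes "is_extended_knots m x u" "-2 \<le> p" "p \<le> q" "q \<le> m + 2"
  shows "u p \<le> u q"
  using extended_knots_less[OF assms(1,2)] assms(3,4) by (cases "p = q") force+

text \<open>All cells beyond the support fall into one of the outer half-lines, which is why the
  index is clamped to the five slabs.\<close>

lemma extended_knots_subset_slab:
  assumes "is_extended_knots m x u" "i \<in> {0..m + 1}" "p \<in> {- 1..m + 2}"
  defines "r \<equiv> max (i - 2) (min (i + 2) p)"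
  shows "{u (p - 1)..u p} \<subseteq> slab u i r"
proof -
  have "u p \<le> u (i - 2)" if "p \<le> i - 2" using that assms by (intro extended_knots_le[OF assms(1)]) auto
  moreover have "u (i + 1) \<le> u (p - 1)" if "p \<ge> i + 2" using that assms by (intro extended_knots_le[OF assms(1)]) auto
  ultimately show ?thesis by (auto simp: slab_def r_def max_def min_def)
qed

lemma bspline_knots_extended:
  assumes "is_extended_knots m x u" "is_extended_knots n y v" "i \<in> {0..m + 1}" "j \<in> {0..n + 1}"
  shows "bspline_knots u v i j"
  by unfold_locales (rule extended_knots_less[OF assms(1)] extended_knots_less[OF assms(2)]; use assms in auto)+

text \<open>The clamping disappears again: if an index is more than one away from \<open>i\<close>
  or \<open>j\<close>, the coefficients of that factor vanish for the clamped and the original index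
  alike.\<close>

lemma fst_bspline_jet_cell:
  assumes "is_extended_knots m x u" "is_extended_knots n y v" "i \<in> {0..m + 1}" "j \<in> {0..n + 1}"
    "p \<in> {- 1..m + 2}" "q \<in> {- 1..n + 2}" "a \<in> {u (p - 1)..u p}" "b \<in> {v (q - 1)..v q}"
  shows "fst (bspline_jet u v i j (a, b)) = cell_spline (bern u i p) (bern v j q) (loc u p a) (loc v q b)"
proof -
  interpret bspline_knots u v i j by (rule bspline_knots_extended[OF assms(1-4)])
  define p' q' where "p' = max (i - 2) (min (i + 2) p)" and "q' = max (j - 2) (min (j + 2) q)"
  have "a \<in> slab u i p'" "b \<in> slab v j q'"
    using extended_knots_subset_slab[OF assms(1,3,5)] extended_knots_subset_slab[OF assms(2,4,6)] assms(7,8)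
    unfolding p'_def q'_def by blast+
  then have eq: "fst (bspline_jet u v i j (a, b)) =
      cell_spline (bern u i p') (bern v j q') (loc u p' a) (loc v q' b)"
    by (intro fst_bspline_jet_eq) (auto simp: p'_def q'_def)
  show ?thesis
  proof (cases "p \<in> {i - 1..i + 1} \<and> q \<in> {j - 1..j + 1}")
    case True
    then have "p' = p" "q' = q" by (auto simp: p'_def q'_def)
    then show ?thesis using eq by simp
  next
    case False
    then have "bern u i p' = (\<lambda>_. 0) \<and> bern u i p = (\<lambda>_. 0) \<or>
        bern v j q' = (\<lambda>_. 0) \<and> bern v j q = (\<lambda>_. 0)"
      using bern_eq_0[of p' i u] bern_eq_0[of q' j v] bern_eq_0[of p i u] bern_eq_0[of q j v]
      by (auto simp: p'_def q'_def max_def min_def split: if_splits)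
    then show ?thesis
      using eq by (auto simp: cell_zero cell_spline_swap[of _ "\<lambda>_. 0"])
  qed
qed

lemma is_classical_bspline_jet:
  assumes "is_extended_knots m x u" "is_extended_knots n y v" "i \<in> {0..m + 1}" "j \<in> {0..n + 1}"
  shows "is_classical_bspline m n u v i j (\<lambda>P. fst (bspline_jet u v i j P))"
proof -
  interpret bspline_knots u v i j by (rule bspline_knots_extended[OF assms])
  have "quadratic_on T (\<lambda>P. fst (bspline_jet u v i j P))"
    if pq: "p \<in> {- 1..m + 2}" "q \<in> {- 1..n + 2}" and T: "T \<in> cell_triangles u v p q" for p q T
  proof -
    have uv: "u (p - 1) < u p" "v (q - 1) < v q"
      using assms pq by (auto simp: is_extended_knots_def)
    note tr = cell_triangle_signs(3)[OF uv T]
    show ?thesis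
      by (rule quadratic_on_cong[OF quadratic_on_cell_spline[OF uv T, of "bern u i p" "bern v j q"]])
        (use tr fst_bspline_jet_cell[OF assms pq] in auto)
  qed
  moreover have "fst (bspline_jet u v i j (u i, v j)) = (u (i + 1) - u i) / (u (i + 1) - u (i - 1)) *
                    ((v (j + 1) - v j) / (v (j + 1) - v (j - 1)))"
  proof -
    \<comment> \<open>The node is the upper right corner of cell \<open>(i, j)\<close>, where the
      spline equals the product of the last Bernstein coefficients.\<close>
    have "loc u i (u i) = 1" "loc v j (v j) = 1"
      using uinc vinc by (auto simp: loc_def stp_def)
    moreover have "u i \<in> slab u i i" "v j \<in> slab v j j" using uinc vinc by (auto simp: slab_def)
    ultimately show ?thesis
      using fst_bspline_jet_eq[of i "u i" j "v j"]
      by (simp add: cell_edge bern_def node_weight_def stp_def)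
  qed
  moreover have "fst (bspline_jet u v i j P) = 0" if "P \<notin> octagon u v i j" for P
    using bspline_jet_outside that by (cases P) blast
  ultimately show ?thesis
    unfolding is_classical_bspline_def criss_cross_def
    using C1_plane_jet[OF jet_on_bspline_jet] by blast
qed

subsection \<open>Uniqueness of the classical B-splines\<close>

text \<open>Restricted to the segment, \<open>g\<close> is a quadratic in \<open>r\<close>. Its
  derivatives at the ends, taken within \<open>{0..1}\<close> because the formula holds only on
  \<open>T\<close>, must equal the given derivatives along \<open>B - A\<close>.\<close>

lemma quadratic_on_segment:
  fixes g :: "real \<times> real \<Rightarrow> real"
  assumes "quadratic_on T g" "convex T" "A \<in> T" "B \<in> T"
    and der: "(g has_derivative DA) (at A)" "(g has_derivative DB) (at B)"
  shows "\<exists>c. (\<forall>r\<in>{0..1}. g (A + r *\<^sub>R (B - A)) = g A + r * DA (B - A) + r\<^sup>2 * c)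
    \<and> DB (B - A) = DA (B - A) + 2 * c"
proof -
  define w where "w = (\<lambda>r. A + r *\<^sub>R (B - A))"
  have wT: "w r \<in> T" if "r \<in> {0..1}" for r
    using convexD_alt[OF assms(2-4), of r] that by (simp add: w_def algebra_simps)
  obtain a0 a1 a2 a3 a4 a5 where
    g: "\<forall>(s, t)\<in>T. g (s, t) = a0 + a1 * s + a2 * t + a3 * s\<^sup>2 + a4 * s * t + a5 * t\<^sup>2"
    using assms(1) unfolding quadratic_on_def by (elim exE)
  obtain x y where A: "A = (x, y)" by (cases A)
  obtain e f where AB: "B - A = (e, f)" by (cases "B - A")
  define k where "k = a1 * e + a2 * f + 2 * a3 * x * e + a4 * x * f + a4 * y * e + 2 * a5 * y * f"
  define c where "c = a3 * e\<^sup>2 + a4 * e * f + a5 * f\<^sup>2"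
  have gA: "g A = a0 + a1 * x + a2 * y + a3 * x\<^sup>2 + a4 * x * y + a5 * y\<^sup>2"
    using g assms(3) A by auto
  have gw: "g (w r) = g A + k * r + c * r\<^sup>2" if "r \<in> {0..1}" for r
  proof -
    have "w r = (x + r * e, y + r * f)" by (simp add: w_def A AB[unfolded A])
    then have "g (w r) = a0 + a1 * (x + r * e) + a2 * (y + r * f) + a3 * (x + r * e)\<^sup>2
        + a4 * (x + r * e) * (y + r * f) + a5 * (y + r * f)\<^sup>2"
      using g wT[OF that] by auto
    then show ?thesis
      by (simp add: gA k_def c_def power2_eq_square algebra_simps)
  qed
  have wder: "(w has_vector_derivative (B - A)) (at r within {0..1})" for r
    unfolding w_def by (auto intro!: derivative_eq_intros)
  have pder: "((g \<circ> w) has_vector_derivative (k + 2 * c * r)) (at r within {0..1})" if "r \<in> {0..1}" for r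
  proof (rule has_vector_derivative_transform)
    show "((\<lambda>r. g A + k * r + c * r\<^sup>2) has_vector_derivative (k + 2 * c * r)) (at r within {0..1})"
      unfolding has_real_derivative_iff_has_vector_derivative[symmetric]
      by (auto intro!: derivative_eq_intros)
  qed (use that gw in auto)
  have "DA (B - A) = k + 2 * c * 0"
  proof (rule vector_derivative_unique_within)
    show "at (0::real) within {0..1} \<noteq> bot" by (simp add: at_within_Icc_at_right)
    show "((g \<circ> w) has_vector_derivative DA (B - A)) (at 0 within {0..1})"
      using der(1) by (intro vector_derivative_diff_chain_within wder)
        (simp add: w_def has_derivative_at_withinI)
  qed (rule pder, simp)
  moreover have "DB (B - A) = k + 2 * c * 1"
  proof (rule vector_derivative_unique_within)
    show "at (1::real) within {0..1} \<noteq> bot" by (simp add: at_within_Icc_at_left)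
    show "((g \<circ> w) has_vector_derivative DB (B - A)) (at 1 within {0..1})"
      using der(2) by (intro vector_derivative_diff_chain_within wder)
        (simp add: w_def has_derivative_at_withinI)
  qed (rule pder, simp)
  ultimately show ?thesis
    using gw by (intro exI[of _ c]) (auto simp: w_def mult.commute)
qed

text \<open>The trapezoid rule is exact because the derivative along the segment is affine.\<close>

lemma quadratic_on_trapezoid:
  assumes "quadratic_on T g" "convex T" "A \<in> T" "B \<in> T"
    "(g has_derivative DA) (at A)" "(g has_derivative DB) (at B)"
  shows "g B - g A = (DA (B - A) + DB (B - A)) / 2"
proof -
  obtain c where c: "\<forall>r\<in>{0..1}. g (A + r *\<^sub>R (B - A)) = g A + r * DA (B - A) + r\<^sup>2 * c"
    "DB (B - A) = DA (B - A) + 2 * c"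
    using quadratic_on_segment[OF assms] by blast
  from bspec[OF c(1), of 1] c(2) show ?thesis by simp
qed

lemma quadratic_on_segment_zero:
  assumes "quadratic_on T g" "convex T" "A \<in> T" "B \<in> T"
    "(g has_derivative DA) (at A)" "(g has_derivative DB) (at B)"
    "g A = 0" "DA (B - A) = 0" "g B = 0" "P \<in> closed_segment A B"
  shows "g P = 0"
proof -
  obtain c where c: "\<forall>r\<in>{0..1}. g (A + r *\<^sub>R (B - A)) = g A + r * DA (B - A) + r\<^sup>2 * c"
    using quadratic_on_segment[OF assms(1-6)] by blast
  from bspec[OF c, of 1] assms(7-9) have "c = 0" by simp
  moreover obtain r where "r \<in> {0..1}" "P = A + r *\<^sub>R (B - A)"
    using assms(10) by (auto simp: closed_segment_def algebra_simps)
  ultimately show ?thesis using bspec[OF c, of r] assms(7,8) by simp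
qed

section \<open>Vanishing on a cell from zero data at its corners\<close>

lemma cell_covered:
  assumes "u (p - 1) < u p" "v (q - 1) < v q" "x \<in> {u (p - 1)..u p}" "y \<in> {v (q - 1)..v q}"
  shows "\<exists>T\<in>cell_triangles u v p q. (x, y) \<in> T"
proof -
  define s t where "s = loc u p x" and "t = loc v q y"
  have st: "0 \<le> s" "s \<le> 1" "0 \<le> t" "t \<le> 1"
    using assms by (auto simp: s_def t_def loc_def stp_def field_simps)
  have xy: "x = (1 - s) * u (p - 1) + s * u p" "y = (1 - t) * v (q - 1) + t * v q"
    using assms by (simp_all add: s_def t_def loc_def stp_def divide_simps) (simp_all add: algebra_simps)
  have in_hull: "(x, y) \<in> convex hull {P, Q, R}"
    if "0 \<le> a" "0 \<le> b" "0 \<le> c" "a + b + c = 1" "(x, y) = a *\<^sub>R P + b *\<^sub>R Q + c *\<^sub>R R"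
    for a b c :: real and P Q R :: "real \<times> real"
    using that unfolding convex_hull_3 by blast
  let ?z = "(mid u p, mid v q)" and ?sw = "(u (p - 1), v (q - 1))" and ?se = "(u p, v (q - 1))"
    and ?ne = "(u p, v q)" and ?nw = "(u (p - 1), v q)"
  have "(x, y) \<in> convex hull {?z, ?sw, ?se}" if "t \<le> s" "s + t \<le> 1"
    \<comment> \<open>Barycentric coordinates in the four triangles; the center has local
      coordinates \<open>1 / 2\<close>, so its weight is twice the local distance to the opposite
      edge.\<close>
    by (rule in_hull[of "2 * t" "1 - s - t" "s - t"]) (use st that in \<open>auto simp: xy mid_def field_simps\<close>)
  moreover have "(x, y) \<in> convex hull {?z, ?se, ?ne}" if "t \<le> s" "s + t \<ge> 1"
    by (rule in_hull[of "2 * (1 - s)" "s - t" "s + t - 1"]) (use st that in \<open>auto simp: xy mid_def field_simps\<close>)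
  moreover have "(x, y) \<in> convex hull {?z, ?ne, ?nw}" if "t \<ge> s" "s + t \<ge> 1"
    by (rule in_hull[of "2 * (1 - t)" "s + t - 1" "t - s"]) (use st that in \<open>auto simp: xy mid_def field_simps\<close>)
  moreover have "(x, y) \<in> convex hull {?z, ?nw, ?sw}" if "t \<ge> s" "s + t \<le> 1"
    by (rule in_hull[of "2 * s" "t - s" "1 - s - t"]) (use st that in \<open>auto simp: xy mid_def field_simps\<close>)
  ultimately show ?thesis
    unfolding cell_triangles_def Let_def by (metis insertCI linear)
qed

text \<open>The trapezoid rule from a corner \<open>K\<close> to the center \<open>z\<close> gives
  \<open>D z (z - K) = 2 * g z\<close>. For opposite corners the directions cancel, so
  \<open>g z = 0\<close>, and \<open>D z\<close> vanishes in all corner directions. Then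
  \<open>g\<close> is zero on the cell edges and on every segment from \<open>z\<close> to an
  edge.\<close>

lemma quadratic_on_cell_zero:
  fixes g :: "real \<times> real \<Rightarrow> real"
  assumes uv: "u (p - 1) < u p" "v (q - 1) < v q"
    and quad: "\<And>T. T \<in> cell_triangles u v p q \<Longrightarrow> quadratic_on T g"
    and der: "\<And>P. (g has_derivative D P) (at P)"
    and corners: "\<And>P. P \<in> {u (p - 1), u p} \<times> {v (q - 1), v q} \<Longrightarrow> g P = 0 \<and> D P = (\<lambda>_. 0)"
    and P: "P \<in> {u (p - 1)..u p} \<times> {v (q - 1)..v q}"
  shows "g P = 0"
proof -
  let ?K = "{u (p - 1), u p} \<times> {v (q - 1), v q}"
  define z where "z = (mid u p, mid v q)"
  have lin: "linear (D Q)" for Q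
    using der[of Q] by (simp add: has_derivative_linear)
  have cv: "convex T" if "T \<in> cell_triangles u v p q" for T
    using that by (auto simp: cell_triangles_def Let_def)
  have radial: "D z (z - K) = 2 * g z" if K: "K \<in> ?K" for K
  proof -
    obtain T where T: "T \<in> cell_triangles u v p q" "z \<in> T" "K \<in> T"
      using K unfolding cell_triangles_def Let_def z_def by (auto intro: hull_inc)
    show ?thesis
      using quadratic_on_trapezoid[OF quad[OF T(1)] cv[OF T(1)] T(3,2) der der] corners[OF K] by simp
  qed
  have "D z ((z - (u (p - 1), v (q - 1))) + (z - (u p, v q))) = 4 * g z"
    using radial[of "(u (p - 1), v (q - 1))"] radial[of "(u p, v q)"]
    by (simp add: linear_add[OF lin])
  moreover have "(z - (u (p - 1), v (q - 1))) + (z - (u p, v q)) = 0"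
    by (simp add: z_def mid_def zero_prod_def field_simps)
  ultimately have gz: "g z = 0" using linear_0[OF lin] by simp
  have Dz: "D z (K - z) = 0" if "K \<in> ?K" for K
    using radial[OF that] gz linear_neg[OF lin, of z "z - K"] by simp
  obtain T where T: "T \<in> cell_triangles u v p q" "P \<in> T"
    using cell_covered[OF uv] P by blast
  obtain A B where AB: "A \<in> ?K" "B \<in> ?K" "T = convex hull {z, A, B}"
    using T(1) unfolding cell_triangles_def Let_def z_def by auto
  have inT: "z \<in> T" "A \<in> T" "B \<in> T" unfolding AB by (auto intro: hull_inc)
  obtain a R where R: "0 \<le> a" "a \<le> 1" "R \<in> closed_segment A B" "P = (1 - a) *\<^sub>R z + a *\<^sub>R R"
  proof -
    have "P \<in> {w. \<exists>a\<ge>0. \<exists>b\<ge>0. \<exists>R. a + b = 1 \<and> R \<in> convex hull {A, B} \<and> w = a *\<^sub>R z + b *\<^sub>R R}"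
      using T(2) unfolding AB convex_hull_insert[of "{A, B}" z, simplified] by auto
    then obtain a b R where "0 \<le> a" "0 \<le> b" "a + b = 1" "R \<in> convex hull {A, B}" "P = a *\<^sub>R z + b *\<^sub>R R"
      by blast
    moreover from this(3) have "a = 1 - b" by simp
    ultimately show thesis by (intro that[of b R]) (auto simp: segment_convex_hull)
  qed
  have RT: "R \<in> T"
    using R(3) inT cv[OF T(1)] convex_contains_segment by blast
  have "g R = 0"
    using quadratic_on_segment_zero[OF quad[OF T(1)] cv[OF T(1)] inT(2,3) der der _ _ _ R(3)]
      corners[OF AB(1)] corners[OF AB(2)] by simp
  moreover have "D z (R - z) = 0"
  proof -
    obtain r where "R = (1 - r) *\<^sub>R A + r *\<^sub>R B" using R(3) by (auto simp: closed_segment_def)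
    then have "R - z = (1 - r) *\<^sub>R (A - z) + r *\<^sub>R (B - z)" by (simp add: algebra_simps)
    then show ?thesis using Dz AB by (simp add: linear_add[OF lin] linear_cmul[OF lin])
  qed
  ultimately show ?thesis
    using quadratic_on_segment_zero[OF quad[OF T(1)] cv[OF T(1)] inT(1) RT der der gz _ _, of P] R
    by (auto simp: closed_segment_def)
qed

text \<open>The normalization fixes the value at \<open>(u i, v j)\<close>; the trapezoid rule along the grid lines
  then propagates from the boundary of the support to the four interior grid points.\<close>

lemma is_classical_bspline_unique:
  assumes knots: "is_extended_knots m x u" "is_extended_knots n y v"
    and ij: "i \<in> {0..m + 1}" "j \<in> {0..n + 1}"
    and f: "is_classical_bspline m n u v i j f" and g: "is_classical_bspline m n u v i j g"
  shows "f = g"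
proof -
  interpret bspline_knots u v i j by (rule bspline_knots_extended[OF knots ij])
  define d where "d = (\<lambda>P. f P - g P)"
  obtain Df where Df: "\<And>P. (f has_derivative blinfun_apply (Df P)) (at P)" "continuous_on UNIV Df"
    using f unfolding is_classical_bspline_def C1_plane_def by blast
  obtain Dg where Dg: "\<And>P. (g has_derivative blinfun_apply (Dg P)) (at P)" "continuous_on UNIV Dg"
    using g unfolding is_classical_bspline_def C1_plane_def by blast
  define D where "D = (\<lambda>P. Df P - Dg P)"
  have der: "(d has_derivative blinfun_apply (D P)) (at P)" for P
    unfolding d_def D_def minus_blinfun.rep_eq by (intro has_derivative_diff Df Dg)
  have contD: "continuous_on UNIV D"
    unfolding D_def by (intro continuous_intros Df Dg)
  have contd: "continuous_on UNIV d"
    using has_derivative_continuous[OF der] by (auto intro: continuous_at_imp_continuous_on)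
  have quad: "quadratic_on T d" if "p \<in> {- 1..m + 2}" "q \<in> {- 1..n + 2}" "T \<in> cell_triangles u v p q" for p q T
  proof -
    have "T \<in> criss_cross m n u v" using that unfolding criss_cross_def by blast
    then have "quadratic_on T f" "quadratic_on T g" using f g unfolding is_classical_bspline_def by auto
    then show ?thesis
      using quadratic_on_add[OF _ quadratic_on_cmult[of T g "-1"], of f] by (simp add: d_def)
  qed
  define R where "R = {u (i - 2)..u (i + 1)} \<times> {v (j - 2)..v (j + 1)}"
  have d0: "d P = 0" if "P \<in> - R" for P
  proof -
    have "P \<notin> octagon u v i j" using that octagon_subset unfolding R_def by blast
    then show ?thesis using f g unfolding is_classical_bspline_def d_def by (simp del: split_paired_All)
  qed
  have oR: "open (- R)" unfolding R_def by (intro open_Compl closed_Times closed_atLeastAtMost)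
  have D0: "D P = 0" if P: "P \<in> - R" for P
  proof -
    have "((\<lambda>_. 0) has_derivative blinfun_apply (D P)) (at P)"
      using has_derivative_transform_within_open[OF der oR P] d0 by auto
    then have "blinfun_apply (D P) = (\<lambda>_. 0)"
      using has_derivative_unique[OF _ has_derivative_const] by blast
    then show ?thesis by (intro blinfun_eqI) simp
  qed
  have "closed {P. d P = 0 \<and> D P = 0}"
    using contd contD by (intro closed_Collect_conj closed_Collect_eq continuous_on_const)
  then have "closure (- R) \<subseteq> {P. d P = 0 \<and> D P = 0}"
    using d0 D0 by (intro closure_minimal) auto
  \<comment> \<open>\<open>d\<close> and its derivative vanish off \<open>R\<close>, hence by
    continuity also on its frontier, where the outermost grid points of the support lie.\<close>
  then have bdry: "d P = 0 \<and> D P = 0" if "P \<notin> interior R" for P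
    using that by (auto simp: closure_complement)
  define X Y where "X = (\<lambda>p q. D (u p, v q) (1, 0))" and "Y = (\<lambda>p q. D (u p, v q) (0, 1))"
  define e where "e = (\<lambda>p q. d (u p, v q))"
  have outer: "e p q = 0 \<and> X p q = 0 \<and> Y p q = 0" if "p \<in> {i - 2, i + 1} \<or> q \<in> {j - 2, j + 1}" for p q
  proof -
    have "(u p, v q) \<notin> interior R" using that by (auto simp: R_def interior_Times)
    from bdry[OF this] show ?thesis by (simp add: e_def X_def Y_def)
  qed
  have horizontal: "e p q - e (p - 1) q = stp u p / 2 * (X (p - 1) q + X p q)"
    if "p \<in> {i - 1..i + 1}" "q \<in> {j - 1..j}" for p q
  proof -
    \<comment> \<open>The triangle above the grid edge; \<open>q \<le> j\<close> keeps the cell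
      index \<open>q + 1\<close> at most \<open>n + 2\<close>, inside the triangulated
      range.\<close>
    let ?T = "convex hull {(mid u p, mid v (q + 1)), (u (p - 1), v q), (u p, v q)}"
    have "?T \<in> cell_triangles u v p (q + 1)" by (simp add: cell_triangles_def Let_def)
    then have "quadratic_on ?T d" using that ij by (intro quad[of p "q + 1"]) auto
    then have "e p q - e (p - 1) q = (D (u (p - 1), v q) ((u p, v q) - (u (p - 1), v q))
         + D (u p, v q) ((u p, v q) - (u (p - 1), v q))) / 2"
      unfolding e_def by (rule quadratic_on_trapezoid[OF _ convex_convex_hull _ _ der der]) (auto intro: hull_inc)
    moreover have "(u p, v q) - (u (p - 1), v q) = stp u p *\<^sub>R (1, 0)" by (simp add: stp_def)
    ultimately show ?thesis by (simp add: X_def blinfun.scaleR_right algebra_simps del: scaleR_Pair)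
  qed
  have vertical: "e p q - e p (q - 1) = stp v q / 2 * (Y p (q - 1) + Y p q)"
    if "q \<in> {j - 1..j + 1}" "p \<in> {i - 1..i}" for p q
  proof -
    let ?T = "convex hull {(mid u (p + 1), mid v q), (u p, v q), (u p, v (q - 1))}"
    have "?T \<in> cell_triangles u v (p + 1) q" by (simp add: cell_triangles_def Let_def)
    then have "quadratic_on ?T d" using that ij by (intro quad[of "p + 1" q]) auto
    then have "e p q - e p (q - 1) = (D (u p, v (q - 1)) ((u p, v q) - (u p, v (q - 1)))
         + D (u p, v q) ((u p, v q) - (u p, v (q - 1)))) / 2"
      unfolding e_def by (rule quadratic_on_trapezoid[OF _ convex_convex_hull _ _ der der]) (auto intro: hull_inc)
    moreover have "(u p, v q) - (u p, v (q - 1)) = stp v q *\<^sub>R (0, 1)" by (simp add: stp_def)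
    ultimately show ?thesis by (simp add: Y_def blinfun.scaleR_right algebra_simps del: scaleR_Pair)
  qed
  note su = stp_pos[OF uinc] and sv = stp_pos[OF vinc]
  \<comment> \<open>Two consecutive grid edges with zero data at both outer ends: the trapezoid rule
    gives two relations between the inner value \<open>a\<close> and slope \<open>b\<close>, which
    force both to vanish.\<close>
  have between: "a = 0 \<and> b = 0" if "a = h / 2 * b" "- a = h' / 2 * b" "0 < h" "0 < h'" for a b h h' :: real
  proof -
    have "(h + h') * b = 0" using that(1,2) by (simp add: algebra_simps)
    then show ?thesis using that by simp
  qed
  have e1: "e i j = 0"
    using f g unfolding e_def d_def is_classical_bspline_def by simp
  have X1: "X i j = 0" using horizontal[of "i + 1" j] e1 outer[of "i + 1" j] su by simp
  have Y1: "Y i j = 0" using vertical[of "j + 1" i] e1 outer[of i "j + 1"] sv by simp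
  have 2: "e (i - 1) j = 0 \<and> X (i - 1) j = 0"
    using horizontal[of i j] horizontal[of "i - 1" j] e1 X1 outer[of "i - 2" j] su
    by (intro between[of _ "stp u (i - 1)" _ "stp u i"]) auto
  then have Y2: "Y (i - 1) j = 0" using vertical[of "j + 1" "i - 1"] outer[of "i - 1" "j + 1"] sv by simp
  have 3: "e i (j - 1) = 0 \<and> Y i (j - 1) = 0"
    using vertical[of j i] vertical[of "j - 1" i] e1 Y1 outer[of i "j - 2"] sv
    by (intro between[of _ "stp v (j - 1)" _ "stp v j"]) auto
  then have X3: "X i (j - 1) = 0" using horizontal[of "i + 1" "j - 1"] outer[of "i + 1" "j - 1"] su by simp
  have 4: "e (i - 1) (j - 1) = 0 \<and> X (i - 1) (j - 1) = 0"
    using horizontal[of i "j - 1"] horizontal[of "i - 1" "j - 1"] 3 X3 outer[of "i - 2" "j - 1"] su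
    by (intro between[of _ "stp u (i - 1)" _ "stp u i"]) auto
  have Y4: "Y (i - 1) (j - 1) = 0"
    using vertical[of j "i - 1"] 2 4 Y2 sv by simp
  have nodes: "e p q = 0 \<and> X p q = 0 \<and> Y p q = 0" if "p \<in> {i - 2..i + 1}" "q \<in> {j - 2..j + 1}" for p q
  proof (cases "p \<in> {i - 2, i + 1} \<or> q \<in> {j - 2, j + 1}")
    case False
    then have "p = i - 1 \<or> p = i" "q = j - 1 \<or> q = j" using that by auto
    then show ?thesis using e1 X1 Y1 2 Y2 3 X3 4 Y4 by auto
  qed (rule outer)
  have Dnode: "blinfun_apply (D (u p, v q)) = (\<lambda>_. 0)" if "p \<in> {i - 2..i + 1}" "q \<in> {j - 2..j + 1}" for p q
  proof
    fix V :: "real \<times> real"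
    have "V = fst V *\<^sub>R (1, 0) + snd V *\<^sub>R (0, 1)" by (cases V) simp
    then have "D (u p, v q) V = fst V *\<^sub>R X p q + snd V *\<^sub>R Y p q"
      unfolding X_def Y_def by (metis blinfun.add_right blinfun.scaleR_right)
    then show "D (u p, v q) V = 0" using nodes[OF that] by simp
  qed
  have cell: "d P = 0" if pq: "p \<in> {i - 1..i + 1}" "q \<in> {j - 1..j + 1}"
    and P: "P \<in> {u (p - 1)..u p} \<times> {v (q - 1)..v q}" for p q P
  proof (rule quadratic_on_cell_zero[OF _ _ _ der _ P])
    show "u (p - 1) < u p" "v (q - 1) < v q"
      using stp_pos'[OF uinc pq(1)] stp_pos'[OF vinc pq(2)] by (simp_all add: stp_def)
    show "quadratic_on T d" if "T \<in> cell_triangles u v p q" for T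
      using that pq ij by (intro quad[of p q]) auto
    show "d K = 0 \<and> blinfun_apply (D K) = (\<lambda>_. 0)" if "K \<in> {u (p - 1), u p} \<times> {v (q - 1), v q}" for K
      using that nodes Dnode pq by (auto simp: e_def)
  qed
  have "d P = 0" for P
  proof (cases "P \<in> R")
    case True
    obtain a b where P: "P = (a, b)" by (cases P)
    have three: "\<exists>p\<in>{k - 1..k + 1}. z \<in> {w (p - 1)..w p}" if "z \<in> {w (k - 2)..w (k + 1)}"
      for k :: int and w and z :: real
    proof -
      have "z \<in> {w (k - 1 - 1)..w (k - 1)} \<or> z \<in> {w (k - 1)..w k} \<or> z \<in> {w (k + 1 - 1)..w (k + 1)}"
        using that by auto
      then show ?thesis by (elim disjE) (rule bexI, assumption, simp)+
    qed
    have "a \<in> {u (i - 2)..u (i + 1)}" "b \<in> {v (j - 2)..v (j + 1)}"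
      using True by (auto simp: R_def P)
    from three[OF this(1)] three[OF this(2)] obtain p q where "p \<in> {i - 1..i + 1}" "q \<in> {j - 1..j + 1}" "a \<in> {u (p - 1)..u p}" "b \<in> {v (q - 1)..v q}"
      by blast
    then show ?thesis using cell[of p q P] by (auto simp: P)
  qed (simp add: d0)
  then show ?thesis by (auto simp: d_def fun_eq_iff)
qed

lemma classical_bspline_eq:
  assumes "is_extended_knots m x u" "is_extended_knots n y v" "i \<in> {0..m + 1}" "j \<in> {0..n + 1}"
  shows "classical_bspline m n u v i j = (\<lambda>P. fst (bspline_jet u v i j P))"
  unfolding classical_bspline_def
  using is_classical_bspline_jet[OF assms] is_classical_bspline_unique[OF assms]
  by (intro the_equality) auto

subsection \<open>The B-splines on the domain\<close>

text \<open>Bernstein coefficients on \<open>[u (p - 1), u p]\<close> of a univariate factor of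
  \<open>bspline\<close>. For cells of the domain they are those of the quadratic B-splines with
  triple end knots, see \<open>bdry_bern_eq\<close>.\<close>

definition bdry_bern :: "int \<Rightarrow> (int \<Rightarrow> real) \<Rightarrow> int \<Rightarrow> int \<Rightarrow> nat \<Rightarrow> real" where
  "bdry_bern m u i p k = (\<Sum>r\<in>{0..m + 1}. bdry_coeff m u i r * bern u r p k)"

text \<open>The cell spline is linear in each coefficient vector, so the boundary combination can be
  carried out separately in each variable.\<close>

lemma bspline_cell:
  assumes "is_extended_knots m x u" "is_extended_knots n y v" "p \<in> {1..m}" "q \<in> {1..n}"
    "a \<in> {u (p - 1)..u p}" "b \<in> {v (q - 1)..v q}"
  shows "bspline m n u v i j (a, b) =
    cell_spline (bdry_bern m u i p) (bdry_bern n v j q) (loc u p a) (loc v q b)"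
proof -
  have "bspline m n u v i j (a, b) = (\<Sum>r\<in>{0..m + 1}. \<Sum>s\<in>{0..n + 1}. bdry_coeff m u i r *
      (bdry_coeff n v j s * cell_spline (bern u r p) (bern v s q) (loc u p a) (loc v q b)))"
    unfolding bspline_def
    by (intro sum.cong refl) (use assms in \<open>simp add: classical_bspline_eq fst_bspline_jet_cell mult.assoc\<close>)
  then show ?thesis
    unfolding bdry_bern_def cell_spline_sum_left cell_spline_sum_right by (simp add: sum_distrib_left)
qed

text \<open>Only the B-splines \<open>p\<close> and \<open>p + 1\<close> are nonzero at
  \<open>u p\<close>. At an end knot the contributions to \<open>i = 1\<close>, respectively
  \<open>i = m\<close>, cancel, and a single function remains with value \<open>1\<close>; at
  interior knots nothing changes.\<close>

lemma sum_bdry_node_weight: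
  assumes "is_extended_knots m x u" "1 \<le> m" "p \<in> {0..m}" "i \<in> {0..m + 1}"
  shows "(\<Sum>r\<in>{0..m + 1}. bdry_coeff m u i r * node_weight u r p) =
    (if p = 0 then (if i = 0 then 1 else 0) else if p = m then (if i = m + 1 then 1 else 0)
     else (if i = p then stp u (p + 1) / (stp u p + stp u (p + 1)) else 0)
        + (if i = p + 1 then stp u p / (stp u p + stp u (p + 1)) else 0))"
proof -
  have "u (p - 1) < u p" "u (p + 1 - 1) < u (p + 1)"
    using assms(3) by (auto intro!: extended_knots_less[OF assms(1)])
  then have pos: "0 < stp u p" "0 < stp u (p + 1)" by (auto simp: stp_def)
  have "(\<Sum>r\<in>{0..m + 1}. bdry_coeff m u i r * node_weight u r p)
      = (\<Sum>r\<in>{p, p + 1}. bdry_coeff m u i r * node_weight u r p)"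
    using assms(3) by (intro sum.mono_neutral_right) (auto simp: node_weight_def)
  also have "\<dots> = bdry_coeff m u i p * (stp u (p + 1) / (stp u p + stp u (p + 1)))
      + bdry_coeff m u i (p + 1) * (stp u p / (stp u p + stp u (p + 1)))"
    by (simp add: node_weight_def)
  also have "\<dots> = (if p = 0 then (if i = 0 then 1 else 0) else if p = m then (if i = m + 1 then 1 else 0)
     else (if i = p then stp u (p + 1) / (stp u p + stp u (p + 1)) else 0)
        + (if i = p + 1 then stp u p / (stp u p + stp u (p + 1)) else 0))"
  proof -
    \<comment> \<open>For the steps \<open>a\<close> and \<open>b\<close> before and after
      \<open>u p\<close>: the first two identities serve \<open>p = 0\<close>, the last two
      \<open>p = m\<close>.\<close>
    have cancel: "(a + b) / b * (b / (a + b)) = 1" "- (a / b) * (b / (a + b)) + a / (a + b) = 0"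
      "(a + b) / a * (a / (a + b)) = 1" "b / (a + b) - b / a * (a / (a + b)) = 0"
      if "0 < a" "0 < b" for a b :: real
      using that by (auto simp: divide_simps)
    consider "p = 0" | "p = m" "p \<noteq> 0" | "1 \<le> p" "p < m" using assms(3) by force
    then show ?thesis
    proof cases
      case 1
      then show ?thesis using cancel(1,2)[OF pos] assms(2,4) by (auto simp: bdry_coeff_def)
    next
      case 2
      then show ?thesis using cancel(3,4)[OF pos] assms(2,4) by (auto simp: bdry_coeff_def)
    next
      case 3
      then show ?thesis using assms(4) by (auto simp: bdry_coeff_def)
    qed
  qed
  finally show ?thesis .
qed

lemma bdry_bern_middle:
  assumes "p \<in> {1..m}"
  shows "bdry_bern m u i p 1 = (if i = p then 1 else 0)"
proof -
  have "bdry_bern m u i p 1 = (\<Sum>r\<in>{0..m + 1}. if r = p then bdry_coeff m u i r else 0)"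
    unfolding bdry_bern_def by (intro sum.cong) (auto simp: bern_def)
  also have "\<dots> = bdry_coeff m u i p" using assms by simp
  finally show ?thesis using assms by (auto simp: bdry_coeff_def)
qed

section \<open>Positivity, locality and partition of unity\<close>

context
  fixes m :: int and x u :: "int \<Rightarrow> real" and p :: int
  assumes knots: "is_extended_knots m x u" and m: "1 \<le> m" and p: "p \<in> {1..m}"
begin

lemma bdry_bern_eq:
  "i \<in> {0..m + 1} \<Longrightarrow> bdry_bern m u i p 0 =
    (if p - 1 = 0 then (if i = 0 then 1 else 0)
     else (if i = p - 1 then stp u p / (stp u (p - 1) + stp u p) else 0)
        + (if i = p then stp u (p - 1) / (stp u (p - 1) + stp u p) else 0))"
  "i \<in> {0..m + 1} \<Longrightarrow> k \<noteq> 0 \<Longrightarrow> k \<noteq> 1 \<Longrightarrow> bdry_bern m u i p k =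
    (if p = m then (if i = m + 1 then 1 else 0)
     else (if i = p then stp u (p + 1) / (stp u p + stp u (p + 1)) else 0)
        + (if i = p + 1 then stp u p / (stp u p + stp u (p + 1)) else 0))"
proof -
  assume i: "i \<in> {0..m + 1}"
  have r: "p - 1 \<in> {0..m}" "p \<in> {0..m}" using p by auto
  show "bdry_bern m u i p 0 =
    (if p - 1 = 0 then (if i = 0 then 1 else 0)
     else (if i = p - 1 then stp u p / (stp u (p - 1) + stp u p) else 0)
        + (if i = p then stp u (p - 1) / (stp u (p - 1) + stp u p) else 0))"
    using sum_bdry_node_weight[OF knots m r(1) i] p by (simp add: bdry_bern_def bern_def)
  assume "k \<noteq> 0" "k \<noteq> 1"
  then show "bdry_bern m u i p k =
    (if p = m then (if i = m + 1 then 1 else 0)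
     else (if i = p then stp u (p + 1) / (stp u p + stp u (p + 1)) else 0)
        + (if i = p + 1 then stp u p / (stp u p + stp u (p + 1)) else 0))"
    using sum_bdry_node_weight[OF knots m r(2) i] p by (simp add: bdry_bern_def bern_def)
qed

lemma stp_extended_pos: "r \<in> {- 1..m + 2} \<Longrightarrow> 0 < stp u r"
  using knots by (simp add: is_extended_knots_def stp_def)

text \<open>Some \<open>bdry_coeff\<close> are negative, so the sign is read off only after
  summation, from the explicit values.\<close>

lemma bdry_bern_nonneg: "i \<in> {0..m + 1} \<Longrightarrow> 0 \<le> bdry_bern m u i p k"
proof -
  assume i: "i \<in> {0..m + 1}"
  have "0 < stp u (p - 1)" "0 < stp u p" "0 < stp u (p + 1)"
    using p by (auto intro!: stp_extended_pos)
  then show ?thesis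
    using bdry_bern_eq(1)[OF i] bdry_bern_eq(2)[OF i, of k] bdry_bern_middle[OF p, of u i]
    by (cases "k = 0"; cases "k = 1") simp_all
qed

lemma bdry_bern_local:
  assumes "i \<in> {0..m + 1}" "1 < \<bar>i - p\<bar>"
  shows "bdry_bern m u i p = (\<lambda>_. 0)"
proof
  show "bdry_bern m u i p k = 0" for k
    using bdry_bern_eq(1)[OF assms(1)] bdry_bern_eq(2)[OF assms(1), of k] bdry_bern_middle[OF p, of u i] assms(2)
    by (cases "k = 0"; cases "k = 1") auto
qed

text \<open>Partition of unity at the level of coefficients; linearity and
  \<open>cell_spline_one\<close> carry it over to the B-splines on a cell.\<close>

lemma sum_bdry_bern: "(\<Sum>i\<in>{0..m + 1}. bdry_bern m u i p k) = 1"
proof -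
  have pos: "0 < stp u (p - 1)" "0 < stp u p" "0 < stp u (p + 1)"
    using p by (auto intro!: stp_extended_pos)
  consider "k = 0" | "k = 1" | "k \<noteq> 0" "k \<noteq> 1" by blast
  then show ?thesis
  proof cases
    case 1
    have "(\<Sum>i\<in>{0..m + 1}. bdry_bern m u i p k) = (\<Sum>i\<in>{0..m + 1}.
      (if p - 1 = 0 then (if i = 0 then 1 else 0)
     else (if i = p - 1 then stp u p / (stp u (p - 1) + stp u p) else 0)
        + (if i = p then stp u (p - 1) / (stp u (p - 1) + stp u p) else 0)))"
      unfolding 1 by (intro sum.cong refl bdry_bern_eq)
    also have "\<dots> = 1"
      using p pos by (cases "p = 1") (simp_all add: sum.distrib add_divide_distrib[symmetric] add.commute)
    finally show ?thesis .
  next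
    case 2
    then show ?thesis using p by (simp add: bdry_bern_middle[OF p, simplified])
  next
    case 3
    have "(\<Sum>i\<in>{0..m + 1}. bdry_bern m u i p k) = (\<Sum>i\<in>{0..m + 1}.
      (if p = m then (if i = m + 1 then 1 else 0)
     else (if i = p then stp u (p + 1) / (stp u p + stp u (p + 1)) else 0)
        + (if i = p + 1 then stp u p / (stp u p + stp u (p + 1)) else 0)))"
      by (intro sum.cong refl bdry_bern_eq 3)
    also have "\<dots> = 1"
      using p pos by (cases "p = m") (simp_all add: sum.distrib add_divide_distrib[symmetric] add.commute)
    finally show ?thesis .
  qed
qed

lemma loc_in_unit: "a \<in> {u (p - 1)..u p} \<Longrightarrow> 0 \<le> loc u p a \<and> loc u p a \<le> 1"
  using stp_extended_pos[of p] p by (auto simp: loc_def stp_def field_simps)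

end

text \<open>The B-splines are nonnegative weights with sum \<open>1\<close>, and those more than one
  index away from the cell vanish there. Hence only the nearby \<open>\<mu> i j\<close> have to be
  close to \<open>z\<close>, later the value of \<open>f\<close> at the point.\<close>

lemma quasi_interpolant_error:
  assumes knots: "is_extended_knots m x u" "is_extended_knots n y v" and mn: "1 \<le> m" "1 \<le> n"
    and pq: "p \<in> {1..m}" "q \<in> {1..n}" and ab: "a \<in> {u (p - 1)..u p}" "b \<in> {v (q - 1)..v q}"
    and bound: "\<And>i j. i \<in> {0..m + 1} \<Longrightarrow> j \<in> {0..n + 1} \<Longrightarrow> \<bar>i - p\<bar> \<le> 1 \<Longrightarrow> \<bar>j - q\<bar> \<le> 1 \<Longrightarrow>
      \<bar>z - \<mu> i j\<bar> \<le> K"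
  shows "\<bar>z - (\<Sum>i\<in>{0..m + 1}. \<Sum>j\<in>{0..n + 1}. \<mu> i j * bspline m n u v i j (a, b))\<bar> \<le> K"
proof -
  let ?B = "\<lambda>i j. bspline m n u v i j (a, b)"
  let ?c = "\<lambda>A B. cell_spline A B (loc u p a) (loc v q b)"
  have B: "?B i j = ?c (bdry_bern m u i p) (bdry_bern n v j q)" for i j
    by (rule bspline_cell[OF knots pq ab])
  have nonneg: "0 \<le> ?B i j" if "i \<in> {0..m + 1}" "j \<in> {0..n + 1}" for i j
    unfolding B
    using loc_in_unit[OF knots(1) mn(1) pq(1) ab(1)] loc_in_unit[OF knots(2) mn(2) pq(2) ab(2)]
      bdry_bern_nonneg[OF knots(1) mn(1) pq(1) that(1)] bdry_bern_nonneg[OF knots(2) mn(2) pq(2) that(2)]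
    by (intro cell_spline_nonneg) auto
  have one: "(\<Sum>i\<in>{0..m + 1}. \<Sum>j\<in>{0..n + 1}. ?B i j) = 1"
  proof -
    have "(\<Sum>i\<in>{0..m + 1}. \<Sum>j\<in>{0..n + 1}. ?B i j)
      = ?c (\<lambda>k. \<Sum>i\<in>{0..m + 1}. 1 * bdry_bern m u i p k) (\<lambda>k. \<Sum>j\<in>{0..n + 1}. 1 * bdry_bern n v j q k)"
      unfolding B cell_spline_sum_left cell_spline_sum_right by simp
    also have "\<dots> = ?c (\<lambda>_. 1) (\<lambda>_. 1)"
      using sum_bdry_bern[OF knots(1) mn(1) pq(1)] sum_bdry_bern[OF knots(2) mn(2) pq(2)] by simp
    finally show ?thesis by (simp add: cell_spline_one)
  qed
  have "z - (\<Sum>i\<in>{0..m + 1}. \<Sum>j\<in>{0..n + 1}. \<mu> i j * ?B i j)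
      = z * (\<Sum>i\<in>{0..m + 1}. \<Sum>j\<in>{0..n + 1}. ?B i j) - (\<Sum>i\<in>{0..m + 1}. \<Sum>j\<in>{0..n + 1}. \<mu> i j * ?B i j)"
    by (simp only: one mult_1_right)
  also have "\<dots> = (\<Sum>i\<in>{0..m + 1}. \<Sum>j\<in>{0..n + 1}. (z - \<mu> i j) * ?B i j)"
    by (simp add: sum_distrib_left sum_subtractf[symmetric] left_diff_distrib)
  finally have split: "z - (\<Sum>i\<in>{0..m + 1}. \<Sum>j\<in>{0..n + 1}. \<mu> i j * ?B i j)
      = (\<Sum>i\<in>{0..m + 1}. \<Sum>j\<in>{0..n + 1}. (z - \<mu> i j) * ?B i j)" .
  have "\<bar>\<Sum>i\<in>{0..m + 1}. \<Sum>j\<in>{0..n + 1}. (z - \<mu> i j) * ?B i j\<bar> \<le> (\<Sum>i\<in>{0..m + 1}. \<Sum>j\<in>{0..n + 1}. K * ?B i j)"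
  proof (intro order_trans[OF sum_abs] sum_mono)
    fix i j assume ij: "i \<in> {0..m + 1}" "j \<in> {0..n + 1}"
    show "\<bar>(z - \<mu> i j) * ?B i j\<bar> \<le> K * ?B i j"
    proof (cases "\<bar>i - p\<bar> \<le> 1 \<and> \<bar>j - q\<bar> \<le> 1")
      case True
      then show ?thesis
        using bound[OF ij] nonneg[OF ij] by (simp add: abs_mult mult_right_mono)
    next
      case False
      then have "bdry_bern m u i p = (\<lambda>_. 0) \<or> bdry_bern n v j q = (\<lambda>_. 0)"
        using bdry_bern_local[OF knots(1) mn(1) pq(1) ij(1)] bdry_bern_local[OF knots(2) mn(2) pq(2) ij(2)]
        by force
      then have "?B i j = 0"
        unfolding B by (auto simp: cell_zero cell_spline_swap[of _ "\<lambda>_. 0"])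
      then show ?thesis by simp
    qed
  qed
  also have "\<dots> = K" by (simp only: sum_distrib_left[symmetric] one mult_1_right)
  finally show ?thesis unfolding split .
qed

subsection \<open>The error estimate\<close>

text \<open>Since \<open>modulus\<close> is a supremum, boundedness of \<open>f\<close> on the
  compact set is what makes it an upper bound.\<close>

lemma modulus_bound:
  assumes "compact \<Omega>" "continuous_on \<Omega> f" "M \<in> \<Omega>" "P \<in> \<Omega>" "dist M P \<le> t"
  shows "\<bar>f M - f P\<bar> \<le> modulus \<Omega> f t"
proof -
  obtain K where K: "\<And>P. P \<in> \<Omega> \<Longrightarrow> \<bar>f P\<bar> \<le> K"
    using compact_imp_bounded[OF compact_continuous_image[OF assms(2,1)]]
    unfolding bounded_iff by auto
  have "bdd_above {\<bar>f M - f P\<bar> | M P. M \<in> \<Omega> \<and> P \<in> \<Omega> \<and> dist M P \<le> t}"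
  proof (rule bdd_aboveI)
    fix r assume "r \<in> {\<bar>f M - f P\<bar> | M P. M \<in> \<Omega> \<and> P \<in> \<Omega> \<and> dist M P \<le> t}"
    then obtain M P where "r = \<bar>f M - f P\<bar>" "M \<in> \<Omega>" "P \<in> \<Omega>" by blast
    then show "r \<le> 2 * K" using K[of M] K[of P] by linarith
  qed
  then show ?thesis unfolding modulus_def using assms(3-5) by (intro cSup_upper) blast
qed

text \<open>Walk from \<open>M\<close> to \<open>P\<close> in \<open>k\<close> equal steps;
  convexity keeps the intermediate points in the domain.\<close>

lemma modulus_multiple:
  assumes "compact \<Omega>" "convex \<Omega>" "continuous_on \<Omega> f" "M \<in> \<Omega>" "P \<in> \<Omega>" "dist M P \<le> real k * t"
  shows "\<bar>f M - f P\<bar> \<le> real k * modulus \<Omega> f t"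
  using assms(4,6)
proof (induction k arbitrary: M)
  case 0
  then show ?case by simp
next
  case (Suc k)
  define r Q where "r = 1 / real (Suc k)" and "Q = (1 - r) *\<^sub>R M + r *\<^sub>R P"
  have r: "0 \<le> r" "r \<le> 1" by (auto simp: r_def)
  have Q: "Q \<in> \<Omega>" unfolding Q_def using r Suc.prems(1) assms(5) by (intro convexD_alt[OF assms(2)])
  have "M - Q = r *\<^sub>R (M - P)" "Q - P = (1 - r) *\<^sub>R (M - P)" by (simp_all add: Q_def algebra_simps)
  then have MQ: "dist M Q = r * dist M P" and QP: "dist Q P = (1 - r) * dist M P"
    using r by (simp_all add: dist_norm)
  have "dist M Q \<le> r * (real (Suc k) * t)"
    unfolding MQ using Suc.prems(2) r by (intro mult_left_mono)
  then have "dist M Q \<le> t" by (simp add: r_def)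
  then have "\<bar>f M - f Q\<bar> \<le> modulus \<Omega> f t"
    using modulus_bound[OF assms(1,3) Suc.prems(1) Q] by simp
  moreover have "dist Q P \<le> (1 - r) * (real (Suc k) * t)"
    unfolding QP using Suc.prems(2) r by (intro mult_left_mono) auto
  then have "dist Q P \<le> real k * t" by (simp add: r_def divide_simps)
  then have "\<bar>f Q - f P\<bar> \<le> real k * modulus \<Omega> f t"
    using Suc.IH[OF Q] by simp
  ultimately show ?case by (simp add: algebra_simps)
qed

text \<open>The constant \<open>3 / 2\<close> is a rational upper bound for the square root of
  \<open>2\<close>.\<close>

lemma dist_Pair_le:
  fixes a b c d :: real
  assumes "\<bar>a - c\<bar> \<le> r" "\<bar>b - d\<bar> \<le> r"
  shows "dist (a, b) (c, d) \<le> 3 / 2 * r"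
proof -
  have "(dist a c)\<^sup>2 \<le> r\<^sup>2" "(dist b d)\<^sup>2 \<le> r\<^sup>2"
    using assms by (auto simp: dist_real_def intro!: power2_le_iff_abs_le[THEN iffD2])
  then have "(dist a c)\<^sup>2 + (dist b d)\<^sup>2 \<le> (3 / 2 * r)\<^sup>2"
  proof -
    have "(3 / 2 * r)\<^sup>2 = 9 / 4 * r\<^sup>2" by (simp add: power2_eq_square)
    moreover have "0 \<le> r\<^sup>2" by simp
    ultimately show ?thesis
      using \<open>(dist a c)\<^sup>2 \<le> r\<^sup>2\<close> \<open>(dist b d)\<^sup>2 \<le> r\<^sup>2\<close> by linarith
  qed
  then show ?thesis unfolding dist_Pair_Pair using assms by (intro real_le_lsqrt) auto
qed

section \<open>Steps, midpoints and coefficients of a partition\<close>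

context
  fixes m :: int and a b :: real and x :: "int \<Rightarrow> real"
  assumes part: "is_partition m a b x" and m: "1 \<le> m"
begin

lemma stp_nonneg: "i \<in> {0..m + 1} \<Longrightarrow> 0 \<le> stp x i"
proof -
  assume "i \<in> {0..m + 1}"
  then consider "i = 0" | "i = m + 1" | "i \<in> {1..m}" by force
  then show ?thesis using part by cases (auto simp: is_partition_def stp_def less_imp_le)
qed

lemma partition_mono: "- 1 \<le> i \<Longrightarrow> i \<le> j \<Longrightarrow> j \<le> m + 1 \<Longrightarrow> x i \<le> x j"
proof (rotate_tac 1, induction j rule: int_ge_induct)
  case (step j)
  then show ?case using stp_nonneg[of "j + 1"] by (simp add: stp_def)
qed simp

lemma partition_range: "i \<in> {- 1..m + 1} \<Longrightarrow> a \<le> x i \<and> x i \<le> b"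
  using partition_mono[of "- 1" i] partition_mono[of i "m + 1"] part
  by (auto simp: is_partition_def)

lemma mid_range: "i \<in> {0..m + 1} \<Longrightarrow> a \<le> mid x i \<and> mid x i \<le> b"
  using partition_range[of "i - 1"] partition_range[of i] by (auto simp: mid_def)

lemma partition_cell:
  assumes "a \<le> s" "s \<le> b"
  obtains p where "p \<in> {1..m}" "s \<in> {x (p - 1)..x p}"
proof -
  have "\<exists>p\<in>{1..k}. s \<in> {x (p - 1)..x p}" if "1 \<le> k" "s \<le> x k" for k
    using that
  proof (induction k rule: int_ge_induct)
    case base
    then show ?case using assms part by (auto simp: is_partition_def)
  next
    case (step k)
    show ?case
    proof (cases "s \<le> x k")
      case True
      then show ?thesis using step.IH by force
    next
      case False
      then show ?thesis using step by (intro bexI[of _ "k + 1"]) auto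
    qed
  qed
  from this[OF m] show thesis using assms part that by (auto simp: is_partition_def)
qed

lemma sigma_range: "i \<in> {1..m + 1} \<Longrightarrow> 0 \<le> sigma m x i \<and> sigma m x i \<le> 1"
  using stp_nonneg[of i] stp_nonneg[of "i - 1"]
  by (auto simp: sigma_def divide_le_eq_1)

text \<open>For \<open>s = sigma m x i\<close> and \<open>t = sigma' m x (i + 1)\<close> the two
  quotients add up to \<open>s * t\<close> when \<open>s + t\<close> is nonzero, a product of
  numbers in the unit interval.\<close>

lemma a_c_coeff: "a_coeff m x i \<le> 0" "c_coeff m x i \<le> 0" "- (a_coeff m x i + c_coeff m x i) \<le> 1"
proof -
  have *: "0 \<le> s\<^sup>2 * t / (s + t)" "0 \<le> s * t\<^sup>2 / (s + t)" "s\<^sup>2 * t / (s + t) + s * t\<^sup>2 / (s + t) \<le> 1"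
    if "0 \<le> s" "s \<le> 1" "0 \<le> t" "t \<le> 1" for s t :: real
  proof -
    show "0 \<le> s\<^sup>2 * t / (s + t)" "0 \<le> s * t\<^sup>2 / (s + t)" using that by auto
    have "s\<^sup>2 * t + s * t\<^sup>2 = s * t * (s + t)"
      by (simp add: power2_eq_square algebra_simps)
    then have "s\<^sup>2 * t / (s + t) + s * t\<^sup>2 / (s + t) = s * t * ((s + t) / (s + t))"
      by (simp only: add_divide_distrib[symmetric] times_divide_eq_right)
    \<comment> \<open>The quotient \<open>(s + t) / (s + t)\<close> is \<open>1\<close>, or
      \<open>0\<close> by the division convention; the inequality covers both cases.\<close>
    also have "\<dots> \<le> s * t * 1" using that by (intro mult_left_mono) auto
    also have "\<dots> \<le> 1" using that by (simp add: mult_le_one)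
    finally show "s\<^sup>2 * t / (s + t) + s * t\<^sup>2 / (s + t) \<le> 1" .
  qed
  have "0 \<le> sigma m x i \<and> sigma m x i \<le> 1 \<and> 0 \<le> sigma' m x (i + 1) \<and> sigma' m x (i + 1) \<le> 1"
    if "1 \<le> i" "i \<le> m"
    using that sigma_range[of i] sigma_range[of "i + 1"] by (auto simp: sigma'_def)
  then show "a_coeff m x i \<le> 0" "c_coeff m x i \<le> 0" "- (a_coeff m x i + c_coeff m x i) \<le> 1"
    using *[of "sigma m x i" "sigma' m x (i + 1)"] by (auto simp: a_coeff_def c_coeff_def)
qed

text \<open>Ensures that every midpoint entering \<open>mu_S2\<close> with a nonzero coefficient
  lies in the domain.\<close>

lemma a_c_coeff_index:
  "a_coeff m x i \<noteq> 0 \<Longrightarrow> i - 1 \<in> {0..m + 1}" "c_coeff m x i \<noteq> 0 \<Longrightarrow> i + 1 \<in> {0..m + 1}"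
  by (auto simp: a_coeff_def c_coeff_def split: if_splits)

lemma stp_le:
  assumes "\<forall>i\<in>{1..m}. stp x i \<le> h" "i \<in> {0..m + 1}"
  shows "stp x i \<le> h"
proof -
  have "0 \<le> h" using bspec[OF assms(1), of 1] stp_nonneg[of 1] m by simp
  moreover have "stp x 0 = 0" "stp x (m + 1) = 0" using part by (simp_all add: is_partition_def stp_def)
  moreover have "i = 0 \<or> i = m + 1 \<or> i \<in> {1..m}" using assms(2) by force
  ultimately show ?thesis using assms(1) by auto
qed

text \<open>The \<open>3 / 2 * h\<close> of the last clause is one full step for the cell of
  \<open>s\<close> plus half a step into the neighbouring cell.\<close>

lemma mid_dist:
  assumes h: "\<forall>i\<in>{1..m}. stp x i \<le> h" and i: "i \<in> {0..m + 1}"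
  shows "i - 1 \<in> {0..m + 1} \<Longrightarrow> \<bar>mid x i - mid x (i - 1)\<bar> \<le> h"
    and "i + 1 \<in> {0..m + 1} \<Longrightarrow> \<bar>mid x i - mid x (i + 1)\<bar> \<le> h"
    and "\<bar>mid x i - x (i - 1)\<bar> \<le> h / 2" "\<bar>mid x i - x i\<bar> \<le> h / 2"
    and "p \<in> {1..m} \<Longrightarrow> \<bar>i - p\<bar> \<le> 1 \<Longrightarrow> s \<in> {x (p - 1)..x p} \<Longrightarrow> \<bar>s - mid x i\<bar> \<le> 3 / 2 * h"
proof -
  note b = stp_nonneg stp_le[OF h]
  show "\<bar>mid x i - mid x (i - 1)\<bar> \<le> h" if "i - 1 \<in> {0..m + 1}"
    using b[OF i] b[OF that] by (auto simp: mid_def stp_def abs_le_iff field_simps)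
  show "\<bar>mid x i - mid x (i + 1)\<bar> \<le> h" if "i + 1 \<in> {0..m + 1}"
    using b[OF i] b[OF that] by (auto simp: mid_def stp_def abs_le_iff field_simps)
  show "\<bar>mid x i - x (i - 1)\<bar> \<le> h / 2" "\<bar>mid x i - x i\<bar> \<le> h / 2"
    using b[OF i] by (auto simp: mid_def stp_def abs_le_iff field_simps)
  assume p: "p \<in> {1..m}" "\<bar>i - p\<bar> \<le> 1" "s \<in> {x (p - 1)..x p}"
  then have "p \<in> {0..m + 1}" by auto
  moreover have "i = p - 1 \<or> i = p \<or> i = p + 1" using p(2) by auto
  ultimately show "\<bar>s - mid x i\<bar> \<le> 3 / 2 * h"
    using b[OF i] b[of p] p(3) by (auto simp: mid_def stp_def abs_le_iff field_simps)
qed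

end

theorem theorem1:
  fixes m n :: int and a b c d :: real and x y u v :: "int \<Rightarrow> real"
    and \<Omega> :: "(real \<times> real) set"
  assumes "1 \<le> m" and "1 \<le> n"
    and "is_partition m a b x" and "is_partition n c d y"
    and "is_extended_knots m x u" and "is_extended_knots n y v"
    and "\<Omega> = {a..b} \<times> {c..d}"
  shows "(\<exists>C\<^sub>0>0. C\<^sub>0 \<le> 20.5 \<and>
            (\<forall>f. continuous_on \<Omega> f \<longrightarrow>
               sup_norm \<Omega> (\<lambda>P. f P - S2 m n x y u v f P)
                 \<le> C\<^sub>0 * modulus \<Omega> f (mesh m n x y / 2)))
       \<and> (\<exists>C\<^sub>0>0. C\<^sub>0 \<le> 12 \<and>
            (\<forall>f. continuous_on \<Omega> f \<longrightarrow>
               sup_norm \<Omega> (\<lambda>P. f P - W2 m n x y u v f P)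
                 \<le> C\<^sub>0 * modulus \<Omega> f (mesh m n x y / 2)))"
proof -
  note mn = assms(1,2) and knots = assms(5,6) and \<Omega> = assms(7)
  note px = assms(3) assms(1) and py = assms(4) assms(2)
  define h where "h = mesh m n x y"
  have hx: "\<forall>i\<in>{1..m}. stp x i \<le> h" and hy: "\<forall>j\<in>{1..n}. stp y j \<le> h"
    unfolding h_def mesh_def by (auto intro!: Max_ge)
  note distx = mid_dist[OF px hx] and disty = mid_dist[OF py hy]
  have comp: "compact \<Omega>" and conv: "convex \<Omega>"
    unfolding \<Omega> by (auto intro: compact_Times convex_Times)
  have ne: "\<Omega> \<noteq> {}"
    using partition_range[OF px, of 0] partition_range[OF py, of 0] mn by (auto simp: \<Omega>)
  have mid_in: "(mid x i, mid y j) \<in> \<Omega>" if "i \<in> {0..m + 1}" "j \<in> {0..n + 1}" for i j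
    using mid_range[OF px that(1)] mid_range[OF py that(2)] by (simp add: \<Omega>)
  have ux: "u p = x p" "u (p - 1) = x (p - 1)" if "p \<in> {1..m}" for p
    using knots(1) that by (auto simp: is_extended_knots_def)
  have vy: "v q = y q" "v (q - 1) = y (q - 1)" if "q \<in> {1..n}" for q
    using knots(2) that by (auto simp: is_extended_knots_def)
  \<comment> \<open>Five moduli pay for the way from \<open>P\<close> to a nearby midpoint,
    \<open>K\<close> for the difference between the functional and the value there.\<close>
  have error: "sup_norm \<Omega> (\<lambda>P. f P - (\<Sum>i\<in>{0..m + 1}. \<Sum>j\<in>{0..n + 1}. \<mu> i j * bspline m n u v i j P))
      \<le> (5 + K) * modulus \<Omega> f (h / 2)"
    if f: "continuous_on \<Omega> f"
      and \<mu>: "\<And>i j. i \<in> {0..m + 1} \<Longrightarrow> j \<in> {0..n + 1} \<Longrightarrow>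
        \<bar>f (mid x i, mid y j) - \<mu> i j\<bar> \<le> K * modulus \<Omega> f (h / 2)" for f \<mu> K
    unfolding sup_norm_def
  proof (rule cSUP_least[OF ne])
    fix P assume P: "P \<in> \<Omega>"
    obtain s t where st: "P = (s, t)" by (cases P)
    obtain p where p: "p \<in> {1..m}" "s \<in> {x (p - 1)..x p}"
      using partition_cell[OF px, of s] P by (auto simp: st \<Omega>)
    obtain q where q: "q \<in> {1..n}" "t \<in> {y (q - 1)..y q}"
      using partition_cell[OF py, of t] P by (auto simp: st \<Omega>)
    show "\<bar>f P - (\<Sum>i\<in>{0..m + 1}. \<Sum>j\<in>{0..n + 1}. \<mu> i j * bspline m n u v i j P)\<bar>
      \<le> (5 + K) * modulus \<Omega> f (h / 2)"
      unfolding st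
    proof (rule quasi_interpolant_error[OF knots mn p(1) q(1)])
      show "s \<in> {u (p - 1)..u p}" "t \<in> {v (q - 1)..v q}" using p q ux vy by auto
      fix i j assume ij: "i \<in> {0..m + 1}" "j \<in> {0..n + 1}" "\<bar>i - p\<bar> \<le> 1" "\<bar>j - q\<bar> \<le> 1"
      \<comment> \<open>One factor \<open>3 / 2\<close> comes from the Euclidean norm, the other
        from \<open>mid_dist\<close>. The product \<open>9 / 4 * h\<close> is four and a half steps
        of length \<open>h / 2\<close>, rounded up to five.\<close>
      have "dist (s, t) (mid x i, mid y j) \<le> 3 / 2 * (3 / 2 * h)"
        using distx(5)[OF ij(1) p(1) ij(3) p(2)] disty(5)[OF ij(2) q(1) ij(4) q(2)] by (intro dist_Pair_le)
      moreover have "0 \<le> h" using distx(3)[OF ij(1)] by linarith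
      ultimately have "dist (s, t) (mid x i, mid y j) \<le> real 5 * (h / 2)" by simp
      from modulus_multiple[OF comp conv f P[unfolded st] mid_in[OF ij(1,2)] this]
      show "\<bar>f (s, t) - \<mu> i j\<bar> \<le> (5 + K) * modulus \<Omega> f (h / 2)"
        using \<mu>[OF ij(1,2)] by (simp add: distrib_right)
    qed
  qed
  have S2: "\<bar>f (mid x i, mid y j) - mu_S2 m n x y i j f\<bar> \<le> 4 * modulus \<Omega> f (h / 2)"
    if f: "continuous_on \<Omega> f" and ij: "i \<in> {0..m + 1}" "j \<in> {0..n + 1}" for f i j
  proof -
    let ?w = "modulus \<Omega> f (h / 2)" and ?z = "f (mid x i, mid y j)"
    have "0 \<le> h" using distx(3)[OF ij(1)] by linarith
    then have w: "0 \<le> ?w"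
      using modulus_bound[OF comp f mid_in[OF ij] mid_in[OF ij], of "h / 2"] by simp
    \<comment> \<open>The point is constrained only for nonzero \<open>\<alpha>\<close>, since a
      neighbouring midpoint may have an index out of range. Two steps of length \<open>h / 2\<close>
      cover the distance \<open>h\<close>.\<close>
    have step: "\<bar>\<alpha> * (?z - f P)\<bar> \<le> - \<alpha> * (2 * ?w)"
      if "\<alpha> \<le> 0" "\<alpha> \<noteq> 0 \<Longrightarrow> P \<in> \<Omega> \<and> dist (mid x i, mid y j) P \<le> h" for \<alpha> P
    proof (cases "\<alpha> = 0")
      case False
      then have "\<bar>?z - f P\<bar> \<le> real 2 * ?w"
        using modulus_multiple[OF comp conv f mid_in[OF ij], of P 2 "h / 2"] that(2) by simp
      then show ?thesis using that(1) by (simp add: abs_mult mult_left_mono_neg)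
    qed simp
    have a: "\<bar>a_coeff m x i * (?z - f (mid x (i - 1), mid y j))\<bar> \<le> - a_coeff m x i * (2 * ?w)"
      using a_c_coeff[OF px, of i] a_c_coeff_index(1)[OF px, of i] mid_in[of "i - 1" j] distx(1)[OF ij(1)] ij
      by (intro step) (auto simp: dist_Pair_Pair dist_real_def)
    have c: "\<bar>c_coeff m x i * (?z - f (mid x (i + 1), mid y j))\<bar> \<le> - c_coeff m x i * (2 * ?w)"
      using a_c_coeff[OF px, of i] a_c_coeff_index(2)[OF px, of i] mid_in[of "i + 1" j] distx(2)[OF ij(1)] ij
      by (intro step) (auto simp: dist_Pair_Pair dist_real_def)
    have a': "\<bar>a_coeff n y j * (?z - f (mid x i, mid y (j - 1)))\<bar> \<le> - a_coeff n y j * (2 * ?w)"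
      using a_c_coeff[OF py, of j] a_c_coeff_index(1)[OF py, of j] mid_in[of i "j - 1"] disty(1)[OF ij(2)] ij
      by (intro step) (auto simp: dist_Pair_Pair dist_real_def)
    have c': "\<bar>c_coeff n y j * (?z - f (mid x i, mid y (j + 1)))\<bar> \<le> - c_coeff n y j * (2 * ?w)"
      using a_c_coeff[OF py, of j] a_c_coeff_index(2)[OF py, of j] mid_in[of i "j + 1"] disty(2)[OF ij(2)] ij
      by (intro step) (auto simp: dist_Pair_Pair dist_real_def)
    \<comment> \<open>The five weights sum to \<open>1\<close>, so only differences with the four
      neighbours remain.\<close>
    have "?z - mu_S2 m n x y i j f =
        a_coeff m x i * (?z - f (mid x (i - 1), mid y j)) + c_coeff m x i * (?z - f (mid x (i + 1), mid y j))
      + (a_coeff n y j * (?z - f (mid x i, mid y (j - 1))) + c_coeff n y j * (?z - f (mid x i, mid y (j + 1))))"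
      by (simp add: mu_S2_def b_coeff_def algebra_simps)
    then have "\<bar>?z - mu_S2 m n x y i j f\<bar>
        \<le> (- (a_coeff m x i + c_coeff m x i) + - (a_coeff n y j + c_coeff n y j)) * (2 * ?w)"
      using a c a' c' by (simp add: algebra_simps)
    \<comment> \<open>By \<open>a_c_coeff\<close> the neighbours in each variable have total weight
      at most \<open>1\<close>, which yields the four moduli.\<close>
    also have "\<dots> \<le> (1 + 1) * (2 * ?w)"
      using a_c_coeff(3)[OF px, of i] a_c_coeff(3)[OF py, of j] w by (intro mult_right_mono add_mono) auto
    finally show ?thesis by simp
  qed
  have W2: "\<bar>f (mid x i, mid y j) - mu_W2 x y i j f\<bar> \<le> 2 * modulus \<Omega> f (h / 2)"
    if f: "continuous_on \<Omega> f" and ij: "i \<in> {0..m + 1}" "j \<in> {0..n + 1}" for f i j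
  proof -
    let ?w = "modulus \<Omega> f (h / 2)" and ?z = "f (mid x i, mid y j)"
    have corner: "\<bar>?z - f (x k, y l)\<bar> \<le> 2 * ?w" if "k \<in> {i - 1, i}" "l \<in> {j - 1, j}" for k l
    proof -
      have "(x k, y l) \<in> \<Omega>"
        using partition_range[OF px, of k] partition_range[OF py, of l] that ij by (auto simp: \<Omega>)
      \<comment> \<open>Half a step in each coordinate, so two steps of length \<open>h / 2\<close>
        suffice.\<close>
      moreover have "dist (mid x i, mid y j) (x k, y l) \<le> 3 / 2 * (h / 2)"
        using distx(3,4)[OF ij(1)] disty(3,4)[OF ij(2)] that by (intro dist_Pair_le) auto
      moreover have "0 \<le> h" using distx(3)[OF ij(1)] by linarith
      ultimately show ?thesis
        using modulus_multiple[OF comp conv f mid_in[OF ij], of "(x k, y l)" 2 "h / 2"] by simp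
    qed
    \<comment> \<open>The weights \<open>2\<close> and four times \<open>- 1 / 4\<close> sum to
      \<open>1\<close>; the error is minus the mean of the four corner differences.\<close>
    have "?z - mu_W2 x y i j f = - (((?z - f (x (i - 1), y (j - 1))) + (?z - f (x (i - 1), y j))
        + (?z - f (x i, y (j - 1))) + (?z - f (x i, y j))) / 4)"
      by (simp add: mu_W2_def field_simps)
    then show ?thesis
      using corner[of "i - 1" "j - 1"] corner[of "i - 1" j] corner[of i "j - 1"] corner[of i j] by simp
  qed
  show ?thesis
  proof (rule conjI)
    have "sup_norm \<Omega> (\<lambda>P. f P - S2 m n x y u v f P) \<le> 9 * modulus \<Omega> f (mesh m n x y / 2)"
      if "continuous_on \<Omega> f" for f
      using error[OF that S2[OF that]] by (simp add: S2_def h_def)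
    then show "\<exists>C\<^sub>0>0. C\<^sub>0 \<le> 20.5 \<and> (\<forall>f. continuous_on \<Omega> f \<longrightarrow>
        sup_norm \<Omega> (\<lambda>P. f P - S2 m n x y u v f P) \<le> C\<^sub>0 * modulus \<Omega> f (mesh m n x y / 2))"
      by (intro exI[of _ "9::real"]) simp
    have "sup_norm \<Omega> (\<lambda>P. f P - W2 m n x y u v f P) \<le> 7 * modulus \<Omega> f (mesh m n x y / 2)"
      if "continuous_on \<Omega> f" for f
      using error[OF that W2[OF that]] by (simp add: W2_def h_def)
    then show "\<exists>C\<^sub>0>0. C\<^sub>0 \<le> 12 \<and> (\<forall>f. continuous_on \<Omega> f \<longrightarrow>
        sup_norm \<Omega> (\<lambda>P. f P - W2 m n x y u v f P) \<le> C\<^sub>0 * modulus \<Omega> f (mesh m n x y / 2))"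
      by (intro exI[of _ "7::real"]) simp
  qed
qed

end
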